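(* Let $p$ be a prime number. Suppose that for every $p$-adic algebraic number $x$ the order type of $\operatorname{Supp}(x)$ is either finite, or $\omega$, or $\omega^\omega$ (Kedlaya's prediction). Then every $p$-adic algebraic number whose support is bounded has finite support.
   Context: Let $W(\overline{\mathbf{F}}_p)$ be the ring of Witt vectors of $\overline{\mathbf{F}}_p$ and $[\cdot]:\overline{\mathbf{F}}_p\to W(\overline{\mathbf{F}}_p)$ the Teichmüller lift. Let $W(\overline{\mathbf{F}}_p)((t^{\mathbf{Q}}))$ be the ring of Hahn series, i.e. formal sums $\sum_{q\in\mathbf{Q}} r_q t^q$ with $r_q\in W(\overline{\mathbf{F}}_p)$ whose support $\{q : r_q\neq 0\}$ is a well-ordered subset of $\mathbf{Q}$, with the usual termwise addition and convolution product. Let $\mathcal{N}$ be the maximal ideal of those $\sum_q r_q t^q$ such that $\sum_{n\in\mathbf{Z}} r_{q+n}p^n=0$ for every $q\in\mathbf{Q}$. The field of $p$-adic Hahn series is $W(\overline{\mathbf{F}}_p)((p^{\mathbf{Q}})) := W(\overline{\mathbf{F}}_p)((t^{\mathbf{Q}}))/\mathcal{N}$; the image of $\sum_q r_q t^q$ is written $\sum_q r_q p^q$. Every element $x$ has a unique standard expansion $x=\sum_{q\in\mathbf{Q}}[r_q]p^q$ with $r_q\in\overline{\mathbf{F}}_p$ and $\{q : r_q\ne 0\}$ well-ordered; its support is $\operatorname{Supp}(x)=\{q\in\mathbf{Q} : r_q\neq 0\}$, a well-ordered subset of $\mathbf{Q}$, whose order type is an ordinal. The support is bounded if it is a bounded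 subset of $\mathbf{Q}$. This field is algebraically closed and contains $W(\overline{\mathbf{F}}_p)[p^{-1}]$, hence $\mathbf{Q}_p$; a $p$-adic algebraic number is an element of it that is algebraic over $\mathbf{Q}_p$. Here $\omega$ is the first infinite ordinal and $\omega^\omega$ is ordinal exponentiation. *)

theory Defs
  imports
    "HOL-Library.Poly_Mapping"
    "Berlekamp_Zassenhaus.Finite_Field"
    "HOL-Algebra.Algebraic_Closure_Type"
    "HOL-Algebra.Algebra"
begin

text \<open>The prime is encoded by a type of prime cardinality: \<open>p = CARD('p)\<close> for
  \<open>'p :: prime_card\<close>. Then \<open>'p mod_ring\<close> is the field with \<open>p\<close> elements.\<close>

type_synonym 'p Fp_bar = "'p mod_ring alg_closure"

text \<open>Polynomials with integer coefficients in two families of indeterminates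
  \<open>X\<^sub>0, X\<^sub>1, \<dots>\<close> (indices \<open>Inl i\<close>) and \<open>Y\<^sub>0, Y\<^sub>1, \<dots>\<close> (indices \<open>Inr i\<close>).
  An outer key is a monomial, mapping each indeterminate to its exponent.\<close>

type_synonym int_mpoly = "((nat + nat) \<Rightarrow>\<^sub>0 nat) \<Rightarrow>\<^sub>0 int"

definition mpoly_var :: "nat + nat \<Rightarrow> int_mpoly" where
  "mpoly_var v = Poly_Mapping.single (Poly_Mapping.single v 1) 1"

definition mpoly_eval :: "(nat + nat \<Rightarrow> 'k::comm_ring_1) \<Rightarrow> int_mpoly \<Rightarrow> 'k" where
  "mpoly_eval a f =
     (\<Sum>m\<in>Poly_Mapping.keys f. of_int (Poly_Mapping.lookup f m) *
        (\<Prod>v\<in>Poly_Mapping.keys m. a v ^ Poly_Mapping.lookup m v))"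

definition ghost :: "nat \<Rightarrow> nat \<Rightarrow> (nat \<Rightarrow> 'r::comm_ring_1) \<Rightarrow> 'r" where
  "ghost p n x = (\<Sum>i\<le>n. of_nat (p ^ i) * x i ^ (p ^ (n - i)))"

text \<open>For prime \<open>p\<close>, Witt's theorem says that the sequences described here exist and are unique.\<close>

definition witt_sum_poly :: "nat \<Rightarrow> nat \<Rightarrow> int_mpoly" where
  "witt_sum_poly p = (THE S. \<forall>n. ghost p n S =
     ghost p n (\<lambda>i. mpoly_var (Inl i)) + ghost p n (\<lambda>i. mpoly_var (Inr i)))"

definition witt_prod_poly :: "nat \<Rightarrow> nat \<Rightarrow> int_mpoly" where
  "witt_prod_poly p = (THE P. \<forall>n. ghost p n P =
     ghost p n (\<lambda>i. mpoly_var (Inl i)) * ghost p n (\<lambda>i. mpoly_var (Inr i)))"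

definition teichmueller :: "'k::comm_ring_1 \<Rightarrow> nat \<Rightarrow> 'k" where
  "teichmueller a = (\<lambda>n. if n = 0 then a else 0)"

definition witt_ring :: "nat \<Rightarrow> (nat \<Rightarrow> 'k::comm_ring_1) ring" where
  "witt_ring p =
     \<lparr>carrier = UNIV,
      monoid.mult = (\<lambda>x y n. mpoly_eval (case_sum x y) (witt_prod_poly p n)),
      one = teichmueller 1,
      ring.zero = (\<lambda>n. 0),
      add = (\<lambda>x y n. mpoly_eval (case_sum x y) (witt_sum_poly p n))\<rparr>"

definition le_on :: "rat set \<Rightarrow> rat rel" where
  "le_on S = {(a, b). a \<in> S \<and> b \<in> S \<and> a \<le> b}"

definition well_ordered :: "rat set \<Rightarrow> bool" where
  "well_ordered S \<longleftrightarrow> well_order_on S (le_on S)"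

text \<open>Ordinals are represented by well-order relations up to \<^const>\<open>ordIso\<close>;
  \<open>\<omega>\<close> is \<^const>\<open>natLeq\<close>.\<close>

definition has_order_type :: "rat set \<Rightarrow> 'b rel \<Rightarrow> bool" where
  "has_order_type S r \<longleftrightarrow> (le_on S, r) \<in> ordIso"

text \<open>The ordinal power \<open>\<alpha>\<^sup>\<beta>\<close> is the set of finitely supported functions \<open>\<beta> \<Rightarrow> \<alpha>\<close>, compared at
  the largest argument at which they differ; here \<open>\<alpha> = \<beta> = \<omega>\<close>. The function \<open>f\<close> stands for
  the Cantor normal form \<open>\<Sum>n. \<omega>\<^sup>n f(n)\<close>, with decreasing exponents.\<close>

definition omega_power_omega :: "(nat \<Rightarrow> nat) rel" where
  "omega_power_omega =
     {(f, g). finite {n. f n \<noteq> 0} \<and> finite {n. g n \<noteq> 0} \<and>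
        (f = g \<or> (let m = Max {n. f n \<noteq> g n} in f m < g m))}"

definition hahn_support :: "('w, 'm) ring_scheme \<Rightarrow> (rat \<Rightarrow> 'w) \<Rightarrow> rat set" where
  "hahn_support R f = {q. f q \<noteq> \<zero>\<^bsub>R\<^esub>}"

definition hahn_monom :: "('w, 'm) ring_scheme \<Rightarrow> 'w \<Rightarrow> rat \<Rightarrow> rat \<Rightarrow> 'w" where
  "hahn_monom R a q = (\<lambda>s. if s = q then a else \<zero>\<^bsub>R\<^esub>)"

definition hahn_ring :: "('w, 'm) ring_scheme \<Rightarrow> (rat \<Rightarrow> 'w) ring" where
  "hahn_ring R =
     \<lparr>carrier = {f. range f \<subseteq> carrier R \<and> well_ordered (hahn_support R f)},
      monoid.mult = (\<lambda>f g q. \<Oplus>\<^bsub>R\<^esub>a\<in>{a. a \<in> hahn_support R f \<and> q - a \<in> hahn_support R g}.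
                        f a \<otimes>\<^bsub>R\<^esub> g (q - a)),
      one = hahn_monom R \<one>\<^bsub>R\<^esub> 0,
      ring.zero = (\<lambda>q. \<zero>\<^bsub>R\<^esub>),
      add = (\<lambda>f g q. f q \<oplus>\<^bsub>R\<^esub> g q)\<rparr>"

text \<open>The series \<open>\<Sum>i. p\<^sup>i a\<^sub>i\<close> converges to \<open>s\<close> in the \<open>p\<close>-adic topology of \<open>R\<close>.\<close>

definition padic_sums :: "('w, 'm) ring_scheme \<Rightarrow> nat \<Rightarrow> (nat \<Rightarrow> 'w) \<Rightarrow> 'w \<Rightarrow> bool" where
  "padic_sums R p a s \<longleftrightarrow>
     (\<forall>M. \<exists>K0. \<forall>K\<ge>K0.
        (\<Oplus>\<^bsub>R\<^esub>i\<in>{..<K}. [(p ^ i)] \<cdot>\<^bsub>R\<^esub> a i) \<ominus>\<^bsub>R\<^esub> s \<in> (\<lambda>c. [(p ^ M)] \<cdot>\<^bsub>R\<^esub> c) ` carrier R)"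

text \<open>The sum \<open>\<Sum>n\<in>\<int>. f(q + n) p\<^sup>n\<close> lives in \<open>R[1/p]\<close>. Since the support of \<open>f\<close> is well-ordered,
  its terms vanish for \<open>n < -m\<close> with \<open>m\<close> large; its vanishing is expressed in \<open>R\<close> after
  multiplication by \<open>p\<^sup>m\<close> (which is injective on the Witt vectors of a perfect field).\<close>

definition hahn_null :: "('w, 'm) ring_scheme \<Rightarrow> nat \<Rightarrow> (rat \<Rightarrow> 'w) set" where
  "hahn_null R p =
     {f \<in> carrier (hahn_ring R). \<forall>q. \<exists>m::nat.
        (\<forall>n::int. n < - int m \<longrightarrow> f (q + of_int n) = \<zero>\<^bsub>R\<^esub>) \<and>
        padic_sums R p (\<lambda>i. f (q - of_nat m + of_nat i)) \<zero>\<^bsub>R\<^esub>}"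

type_synonym 'p padic_hahn = "(rat \<Rightarrow> nat \<Rightarrow> 'p Fp_bar) set"

definition W_Fp_bar :: "(nat \<Rightarrow> 'p::prime_card Fp_bar) ring" where
  "W_Fp_bar = witt_ring CARD('p)"

definition padic_hahn_field :: "'p::prime_card padic_hahn ring" where
  "padic_hahn_field = hahn_ring W_Fp_bar Quot hahn_null W_Fp_bar CARD('p)"

text \<open>The image of \<open>\<Sum>q. f(q) t\<^sup>q\<close> in the quotient, written \<open>\<Sum>q. f(q) p\<^sup>q\<close>.\<close>

definition padic_hahn_of :: "(rat \<Rightarrow> nat \<Rightarrow> 'p::prime_card Fp_bar) \<Rightarrow> 'p padic_hahn" where
  "padic_hahn_of f = hahn_null W_Fp_bar CARD('p) +>\<^bsub>hahn_ring W_Fp_bar\<^esub> f"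

definition standard_expansion :: "'p::prime_card padic_hahn \<Rightarrow> rat \<Rightarrow> 'p Fp_bar" where
  "standard_expansion x =
     (THE r. well_ordered {q. r q \<noteq> 0} \<and> x = padic_hahn_of (\<lambda>q. teichmueller (r q)))"

definition Supp :: "'p::prime_card padic_hahn \<Rightarrow> rat set" where
  "Supp x = {q. standard_expansion x q \<noteq> 0}"

text \<open>\<open>\<int>\<^sub>p = W(\<bbbF>\<^sub>p)\<close>, embedded componentwise into the Witt vectors of the algebraic closure.\<close>

definition Zp :: "(nat \<Rightarrow> 'p::prime_card Fp_bar) set" where
  "Zp = range (\<lambda>a :: nat \<Rightarrow> 'p mod_ring. to_ac \<circ> a)"

text \<open>\<open>\<rat>\<^sub>p = \<int>\<^sub>p[1/p]\<close>, as the set of all \<open>a p\<^sup>-\<^sup>n\<close> with \<open>a \<in> \<int>\<^sub>p\<close>.\<close>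

definition Qp :: "'p::prime_card padic_hahn set" where
  "Qp = {padic_hahn_of (hahn_monom W_Fp_bar a (- of_nat n)) | a (n::nat). a \<in> Zp}"

definition padic_algebraic_number :: "'p::prime_card padic_hahn \<Rightarrow> bool" where
  "padic_algebraic_number x \<longleftrightarrow>
     x \<in> carrier padic_hahn_field \<and> (ring.algebraic padic_hahn_field over Qp) x"

end

theory Submission
  imports Defs
begin

text \<open>Let \<open>x\<close> be a \<open>p\<close>-adic algebraic number whose support \<open>S\<close> is bounded and infinite, and let \<open>N\<close> be an
  integer larger than the diameter of \<open>S\<close>. Multiplying \<open>x\<close> by the scalar \<open>1 + p\<^sup>N\<close> gives another algebraic
  number, \<open>x + p\<^sup>N x\<close>. The supports \<open>S\<close> and \<open>S + N\<close> of the two summands are disjoint, so nothing is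
  carried when they are added: the support of the sum is \<open>S \<union> (S + N)\<close>, two copies of \<open>S\<close> one after the
  other. Its order type \<open>\<alpha> + \<alpha>\<close> is infinite and additively decomposable, whereas \<open>\<omega>\<close> and \<open>\<omega>\<^sup>\<omega>\<close> are additively
  indecomposable. This contradicts the prediction for \<open>(1 + p\<^sup>N) x\<close>.

  The indecomposability is used in this form (\<open>not_order_type_of_doubled_set\<close>): in \<open>\<omega>\<close> and in \<open>\<omega>\<^sup>\<omega>\<close> one can
  add a fixed element \<open>f\<close> to all others (pointwise, on coefficients of Cantor normal forms), which is
  strictly increasing and has all its values above \<open>f\<close>. If \<open>S \<union> (S + N)\<close> had such a type, one could push it
  into \<open>S + N\<close> and then back by \<open>N\<close> into \<open>S\<close>; but no strictly increasing self-map of a well-ordered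
  set moves an element downwards.

  The algebraic half of the argument rests on the structure of the field, which is built here from
  the definitions. Dwork's lemma yields the Witt polynomials, and the ghost map, injective over the
  torsion-free ring of integer polynomials, yields the ring laws for Witt vectors over every
  commutative ring. Over an algebraic closure of \<open>\<bbbF>\<^sub>p\<close> multiplication by \<open>p\<close> is the shift composed with the
  Frobenius map. Hence \<open>p\<close> is not a zero divisor and every Witt vector has a unique Teichmueller digit
  modulo \<open>p\<close>. Both the existence and the uniqueness of standard expansions follow from this, one coset
  of \<open>\<int>\<close> in \<open>\<rat>\<close> at a time: existence by carrying, uniqueness by comparing digits. Hahn series form a ring
  because sums of two well-ordered sets are well-ordered with finite fibres, and the null series form
  an ideal because a congruence modulo \<open>p\<^sup>K\<close> involves only finitely many products. Finally
  \<open>1 + p\<^sup>N\<close> is not a zero divisor in the quotient and preserves \<open>\<rat>\<^sub>p\<close>, so that multiplication by it preserves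
  algebraicity over \<open>\<rat>\<^sub>p\<close> (\<open>algebraic_mult_regular\<close>).\<close>

section \<open>Evaluation of integer polynomials\<close>

definition monom_eval :: "(nat + nat \<Rightarrow> 'k::comm_ring_1) \<Rightarrow> ((nat + nat) \<Rightarrow>\<^sub>0 nat) \<Rightarrow> 'k" where
  "monom_eval a m = (\<Prod>v\<in>Poly_Mapping.keys m. a v ^ Poly_Mapping.lookup m v)"

lemma monom_eval_superset:
  assumes "finite A" "Poly_Mapping.keys m \<subseteq> A"
  shows "monom_eval a m = (\<Prod>v\<in>A. a v ^ Poly_Mapping.lookup m v)"
  unfolding monom_eval_def using assms
  by (intro prod.mono_neutral_left) (auto simp: in_keys_iff)

lemma monom_eval_add: "monom_eval a (m + n) = monom_eval a m * monom_eval a n"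
proof -
  let ?A = "Poly_Mapping.keys m \<union> Poly_Mapping.keys n"
  have "Poly_Mapping.keys (m + n) \<subseteq> ?A" by (rule Poly_Mapping.keys_add)
  then show ?thesis
    by (simp add: monom_eval_superset[of ?A] lookup_add power_add prod.distrib)
qed

lemma monom_eval_0 [simp]: "monom_eval a 0 = 1"
  by (simp add: monom_eval_def)

lemma mpoly_eval_superset:
  assumes "finite A" "Poly_Mapping.keys f \<subseteq> A"
  shows "mpoly_eval a f = (\<Sum>m\<in>A. of_int (Poly_Mapping.lookup f m) * monom_eval a m)"
  unfolding mpoly_eval_def monom_eval_def using assms
  by (intro sum.mono_neutral_left) (auto simp: in_keys_iff)

lemma mpoly_eval_0 [simp]: "mpoly_eval a 0 = 0"
  by (simp add: mpoly_eval_def)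

lemma mpoly_eval_single [simp]:
  "mpoly_eval a (Poly_Mapping.single m c) = of_int c * monom_eval a m"
  by (subst mpoly_eval_superset[of "{m}"]) auto

lemma mpoly_eval_add: "mpoly_eval a (f + g) = mpoly_eval a f + mpoly_eval a g"
proof -
  let ?A = "Poly_Mapping.keys f \<union> Poly_Mapping.keys g"
  have "Poly_Mapping.keys (f + g) \<subseteq> ?A" by (rule Poly_Mapping.keys_add)
  then show ?thesis
    by (simp add: mpoly_eval_superset[of ?A] lookup_add sum.distrib algebra_simps)
qed

lemma int_mpoly_induct [case_names single add]:
  assumes "\<And>m c. P (Poly_Mapping.single m c)" "\<And>f g. P f \<Longrightarrow> P g \<Longrightarrow> P (f + g)"
  shows "P (f :: int_mpoly)"
proof (induction f rule: update_induct)
  case const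
  show ?case using assms(1)[of 0 0] by simp
next
  case (update f m c)
  have "Poly_Mapping.update m c f = f + Poly_Mapping.single m c"
    using update by (intro poly_mapping_eqI)
      (auto simp: lookup_update lookup_add lookup_single in_keys_iff when_def)
  with update assms show ?case by simp
qed

lemma mpoly_eval_mult: "mpoly_eval a (f * g) = mpoly_eval a f * mpoly_eval a g"
proof (induction f rule: int_mpoly_induct)
  case (single m c)
  show ?case
    by (induction g rule: int_mpoly_induct)
      (simp_all add: mult_single monom_eval_add mpoly_eval_add algebra_simps)
qed (simp add: mpoly_eval_add algebra_simps)

lemma mpoly_eval_hom: "comm_ring_hom (mpoly_eval a)"
  by unfold_locales
    (simp_all add: mpoly_eval_add mpoly_eval_mult flip: single_one del: single_one)

lemma mpoly_eval_var [simp]: "mpoly_eval a (mpoly_var v) = a v"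
  by (simp add: mpoly_var_def monom_eval_def)

text \<open>Commuting with evaluation is what makes every operation given by integer polynomials, in
  particular the Witt vector operations, functorial in the coefficient ring.\<close>

lemma (in comm_ring_hom) hom_mpoly_eval:
  "hom (mpoly_eval a f) = mpoly_eval (\<lambda>v. hom (a v)) f"
  by (simp add: mpoly_eval_def hom_distribs)

lemma (in comm_ring_hom) hom_ghost: "hom (ghost p n x) = ghost p n (\<lambda>i. hom (x i))"
  by (simp add: ghost_def hom_distribs)

lemma int_mpoly_torsion_free:
  assumes "of_nat p * f = of_nat p * (g :: int_mpoly)" "p > 0"
  shows "f = g"
proof (rule poly_mapping_eqI)
  fix m
  have *: "Poly_Mapping.lookup (of_nat p * h) m = int p * Poly_Mapping.lookup h m" for h :: int_mpoly
    by (induction p) (simp_all add: algebra_simps lookup_add)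
  show "Poly_Mapping.lookup f m = Poly_Mapping.lookup g m"
    using *[of f] *[of g] assms by simp
qed

lemma int_mpoly_dvd_cancel:
  assumes "of_nat n * f dvd of_nat n * (g :: int_mpoly)" "n > 0"
  shows "f dvd g"
proof -
  from assms(1) obtain k where "of_nat n * g = of_nat n * (f * k)"
    by (elim dvdE) (simp add: mult.assoc)
  then have "g = f * k" by (rule int_mpoly_torsion_free) (rule assms(2))
  then show ?thesis by simp
qed

lemma ghost_split_last: "ghost p n x = (\<Sum>i<n. of_nat (p ^ i) * x i ^ (p ^ (n - i))) + of_nat (p ^ n) * x n"
  by (simp add: ghost_def lessThan_Suc_atMost[symmetric])

text \<open>Over a torsion-free ring the component \<open>x\<^sub>n\<close> is recovered from the \<open>n\<close>-th ghost component and the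
  earlier \<open>x\<^sub>i\<close> by dividing by \<open>p\<^sup>n\<close>. So identities between Witt vectors over such a ring may be
  checked on ghost components, where all operations are componentwise.\<close>

lemma ghost_inject:
  fixes x y :: "nat \<Rightarrow> int_mpoly"
  assumes "p > 0" "\<And>n. ghost p n x = ghost p n y"
  shows "x = y"
proof
  fix n show "x n = y n"
  proof (induction n rule: less_induct)
    case (less n)
    have "of_nat (p ^ n) * x n = of_nat (p ^ n) * y n"
      using assms(2)[of n] less by (simp add: ghost_split_last)
    then show ?case by (rule int_mpoly_torsion_free) (simp add: assms(1))
  qed
qed

section \<open>Dwork's lemma\<close>

lemma freshman_add_dvd:
  fixes a b :: "'a::comm_ring_1"
  assumes "Factorial_Ring.prime p"
  shows "of_nat p dvd (a + b) ^ p - (a ^ p + b ^ p)"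
proof -
  have "p > 0" using assms by (simp add: prime_gt_0_nat)
  have "(a + b) ^ p = (\<Sum>k\<le>p. of_nat (p choose k) * a ^ k * b ^ (p - k))"
    by (rule binomial_ring)
  also have "{..p} = insert 0 (insert p {0<..<p})" using \<open>p > 0\<close> by auto
  finally have "(a + b) ^ p - (a ^ p + b ^ p) = (\<Sum>k\<in>{0<..<p}. of_nat (p choose k) * a ^ k * b ^ (p - k))"
    using \<open>p > 0\<close> by (simp add: algebra_simps)
  moreover have "p dvd (p choose k)" if "k \<in> {0<..<p}" for k
    using that assms by (simp add: dvd_choose_prime)
  then have "of_nat p dvd (of_nat (p choose k) :: 'a)" if "k \<in> {0<..<p}" for k
    using that by (metis dvdE dvd_triv_left of_nat_mult)
  ultimately show ?thesis by (auto intro!: dvd_sum dvd_mult2)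
qed

text \<open>Each \<open>p\<close>-th power gains one factor \<open>p\<close>: in \<open>u\<^sup>p - v\<^sup>p = (u - v) (u\<^sup>p\<^sup>-\<^sup>1 + \<dots> + v\<^sup>p\<^sup>-\<^sup>1)\<close> the second factor is
  congruent to \<open>p v\<^sup>p\<^sup>-\<^sup>1\<close>, hence to zero, modulo \<open>p\<close>.\<close>

lemma power_p_dvd_diff:
  fixes a b :: "'a::comm_ring_1"
  assumes "of_nat p dvd a - b"
  shows "of_nat (p ^ (j + 1)) dvd a ^ (p ^ j) - b ^ (p ^ j)"
proof (induction j)
  case (Suc j)
  let ?u = "a ^ (p ^ j)" and ?v = "b ^ (p ^ j)"
  have uv: "of_nat p dvd ?u - ?v"
  proof -
    have "of_nat p dvd (of_nat (p ^ (j+1)) :: 'a)" by simp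
    with Suc show ?thesis by (rule dvd_trans[rotated])
  qed
  have "?u ^ p - ?v ^ p = (?u - ?v) * (\<Sum>i<p. ?v ^ (p - Suc i) * ?u ^ i)"
    by (rule power_diff_sumr2)
  moreover have "of_nat p dvd (\<Sum>i<p. ?v ^ (p - Suc i) * ?u ^ i)"
  proof -
    have d: "of_nat p dvd ?v ^ (p - Suc i) * ?u ^ i - ?v ^ (p - 1)" if "i < p" for i
    proof -
      have "p - 1 = (p - Suc i) + i" using that by simp
      then have "?v ^ (p - Suc i) * ?u ^ i - ?v ^ (p - 1) = ?v ^ (p - Suc i) * (?u ^ i - ?v ^ i)"
        by (simp only: power_add right_diff_distrib mult.assoc)
      moreover have "?u - ?v dvd ?u ^ i - ?v ^ i" by (subst power_diff_sumr2) simp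
      ultimately show ?thesis using uv by (simp add: dvd_mult dvd_trans[OF uv])
    qed
    have "(\<Sum>i<p. ?v ^ (p - Suc i) * ?u ^ i) =
        (\<Sum>i<p. ?v ^ (p - Suc i) * ?u ^ i - ?v ^ (p - 1)) + of_nat p * ?v ^ (p - 1)"
      by (simp add: sum_subtractf)
    then show ?thesis using d by (auto intro!: dvd_add dvd_sum)
  qed
  ultimately have "of_nat (p ^ (j + 1)) * of_nat p dvd ?u ^ p - ?v ^ p"
    using Suc by (simp add: mult_dvd_mono)
  moreover have "a ^ (p ^ Suc j) = ?u ^ p" "b ^ (p ^ Suc j) = ?v ^ p"
    by (simp_all add: power_mult[symmetric] mult.commute)
  ultimately show ?case by (simp add: algebra_simps)
qed (use assms in simp)

lemma fermat_of_int_dvd: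
  assumes "Factorial_Ring.prime p"
  shows "of_nat p dvd (of_int c :: 'a::comm_ring_1) ^ p - of_int c"
proof -
  have "p > 0" using assms by (simp add: prime_gt_0_nat)
  have pos: "of_nat p dvd (of_nat n :: 'a) ^ p - of_nat n" for n
  proof (induction n)
    case 0
    show ?case using \<open>p > 0\<close> by (simp add: zero_power)
  next
    case (Suc n)
    have "(of_nat (Suc n) :: 'a) ^ p - of_nat (Suc n) =
        ((of_nat n + 1) ^ p - (of_nat n ^ p + 1 ^ p)) + (of_nat n ^ p - of_nat n)"
      by (simp add: algebra_simps)
    then show ?case
      using dvd_add[OF freshman_add_dvd[OF assms, of "of_nat n :: 'a" 1] Suc.IH] by (simp only:)
  qed
  show ?thesis
  proof (cases c rule: int_cases2)
    case (nonneg n)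
    then show ?thesis using pos by simp
  next
    case (nonpos n)
    have "(of_nat n + - of_nat n :: 'a) ^ p = 0"
      using \<open>p > 0\<close> by (simp add: zero_power)
    then have "(of_int c :: 'a) ^ p - of_int c = - ((of_nat n + - of_nat n) ^ p - (of_nat n ^ p + (- of_nat n) ^ p))
        - (of_nat n ^ p - of_nat n)"
      using nonpos by (simp only:) simp
    then show ?thesis
      using freshman_add_dvd[OF assms, of "of_nat n :: 'a" "- of_nat n"] pos
      by (simp only: dvd_diff dvd_minus_iff)
  qed
qed

lemma monom_eval_single [simp]: "monom_eval a (Poly_Mapping.single v n) = a v ^ n"
  by (subst monom_eval_superset[of "{v}"]) auto

lemma monom_eval_var: "monom_eval mpoly_var m = Poly_Mapping.single m 1"
proof (induction m rule: update_induct)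
  case const
  show ?case by (simp add: monom_eval_def)
next
  case (update m v n)
  have "mpoly_var v ^ n = Poly_Mapping.single (Poly_Mapping.single v n) 1" for v n
    by (induction n) (simp_all add: mpoly_var_def mult_single single_add[symmetric])
  moreover have "Poly_Mapping.update v n m = m + Poly_Mapping.single v n"
    using update by (intro poly_mapping_eqI)
      (auto simp: lookup_update lookup_add lookup_single in_keys_iff when_def)
  ultimately show ?case using update by (simp add: monom_eval_add mult_single)
qed

text \<open>An endomorphism that lifts the Frobenius map modulo \<open>p\<close>; this is the extra structure on the
  polynomial ring that detects sequences of ghost components.\<close>

definition frob_lift :: "nat \<Rightarrow> int_mpoly \<Rightarrow> int_mpoly" where
  "frob_lift p = mpoly_eval (\<lambda>v. mpoly_var v ^ p)"

lemma frob_lift_hom: "comm_ring_hom (frob_lift p)"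
  unfolding frob_lift_def by (rule mpoly_eval_hom)

lemma frob_lift_cong:
  assumes "Factorial_Ring.prime p"
  shows "of_nat p dvd frob_lift p f - f ^ p"
proof (induction f rule: int_mpoly_induct)
  case (single m c)
  have frob: "frob_lift p (Poly_Mapping.single m c) = of_int c * monom_eval mpoly_var m ^ p"
    by (simp add: frob_lift_def monom_eval_def prod_power_distrib mult.commute flip: power_mult)
  have "Poly_Mapping.single m c = of_int c * monom_eval mpoly_var m"
    by (simp add: monom_eval_var mult_single flip: single_of_int del: single_of_int)
  then have "Poly_Mapping.single m c ^ p = of_int c ^ p * monom_eval mpoly_var m ^ p"
    by (simp only: power_mult_distrib)
  with frob have "frob_lift p (Poly_Mapping.single m c) - Poly_Mapping.single m c ^ p
      = - (of_int c ^ p - of_int c) * monom_eval mpoly_var m ^ p"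
    by (simp only:) (simp add: algebra_simps)
  moreover have "of_nat p dvd - ((of_int c :: int_mpoly) ^ p - of_int c)"
    using fermat_of_int_dvd[OF assms, of c] by (simp only: dvd_minus_iff)
  ultimately show ?case by (simp only: dvd_mult2)
next
  case (add f g)
  have "frob_lift p (f + g) - (f + g) ^ p =
      (frob_lift p f - f ^ p) + (frob_lift p g - g ^ p) - ((f + g) ^ p - (f ^ p + g ^ p))"
    by (simp add: frob_lift_def mpoly_eval_add)
  then show ?case
    using dvd_diff[OF dvd_add[OF add] freshman_add_dvd[OF assms, of f g]] by (simp only:)
qed

text \<open>Dwork's criterion. It is stable under the ring operations because \<open>frob_lift\<close> is a homomorphism, and
  it holds for the ghost components of a vector of variables because \<open>frob_lift\<close> turns each variable into
  its \<open>p\<close>-th power.\<close>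

definition dwork_seq :: "nat \<Rightarrow> (nat \<Rightarrow> int_mpoly) \<Rightarrow> bool" where
  "dwork_seq p w \<longleftrightarrow> (\<forall>n. of_nat (p ^ Suc n) dvd w (Suc n) - frob_lift p (w n))"

lemma dwork_seq_add: "dwork_seq p v \<Longrightarrow> dwork_seq p w \<Longrightarrow> dwork_seq p (\<lambda>n. v n + w n)"
proof -
  interpret comm_ring_hom "frob_lift p" by (rule frob_lift_hom)
  assume a: "dwork_seq p v" "dwork_seq p w"
  have "v (Suc n) + w (Suc n) - frob_lift p (v n + w n) =
      (v (Suc n) - frob_lift p (v n)) + (w (Suc n) - frob_lift p (w n))" for n
    by (simp add: hom_distribs)
  then show ?thesis using a unfolding dwork_seq_def by (simp only: dvd_add simp_thms)
qed

lemma dwork_seq_mult: "dwork_seq p v \<Longrightarrow> dwork_seq p w \<Longrightarrow> dwork_seq p (\<lambda>n. v n * w n)"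
proof -
  interpret comm_ring_hom "frob_lift p" by (rule frob_lift_hom)
  assume a: "dwork_seq p v" "dwork_seq p w"
  have "v (Suc n) * w (Suc n) - frob_lift p (v n * w n) =
      (v (Suc n) - frob_lift p (v n)) * w (Suc n) + frob_lift p (v n) * (w (Suc n) - frob_lift p (w n))" for n
    by (simp add: hom_distribs algebra_simps)
  then show ?thesis using a unfolding dwork_seq_def by (simp only: dvd_add dvd_mult dvd_mult2 simp_thms)
qed

lemma dwork_seq_uminus: "dwork_seq p v \<Longrightarrow> dwork_seq p (\<lambda>n. - v n)"
proof -
  interpret comm_ring_hom "frob_lift p" by (rule frob_lift_hom)
  assume a: "dwork_seq p v"
  have "- v (Suc n) - frob_lift p (- v n) = - (v (Suc n) - frob_lift p (v n))" for n
    by (simp add: hom_distribs)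
  then show ?thesis using a by (simp only: dwork_seq_def dvd_minus_iff) blast
qed

lemma dwork_seq_ghost_var: "dwork_seq p (\<lambda>n. ghost p n (\<lambda>i. mpoly_var (g i)))"
  unfolding dwork_seq_def
proof
  fix n
  interpret comm_ring_hom "frob_lift p" by (rule frob_lift_hom)
  have "frob_lift p (ghost p n (\<lambda>i. mpoly_var (g i))) =
      (\<Sum>i\<le>n. of_nat (p ^ i) * mpoly_var (g i) ^ (p ^ (Suc n - i)))"
    by (simp add: hom_ghost) (simp add: ghost_def frob_lift_def Suc_diff_le flip: power_mult)
  then show "of_nat (p ^ Suc n) dvd ghost p (Suc n) (\<lambda>i. mpoly_var (g i)) -
      frob_lift p (ghost p n (\<lambda>i. mpoly_var (g i)))"
    by (simp add: ghost_def)
qed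

text \<open>The components are found one after the other. The \<open>n\<close>-th equation can be solved for \<open>S\<^sub>n\<close> exactly
  when \<open>p\<^sup>n\<close> divides \<open>w\<^sub>n - (\<Sum>i<n. p\<^sup>i S\<^sub>i\<^bsup>p^(n-i)\<^esup>)\<close>. The criterion lets one replace \<open>w\<^sub>n\<close> by the image of \<open>w\<^sub>n\<^sub>-\<^sub>1\<close>
  under \<open>frob_lift\<close>, and modulo \<open>p\<^sup>n\<close> that image arises from \<open>w\<^sub>n\<^sub>-\<^sub>1\<close> by replacing each \<open>S\<^sub>i\<close> with \<open>S\<^sub>i\<^sup>p\<close>.\<close>

lemma dwork:
  assumes p: "Factorial_Ring.prime p" and w: "dwork_seq p w"
  shows "\<exists>S. \<forall>n. ghost p n S = w n"
proof -
  let ?P = "\<lambda>S n r. (\<Sum>i<n. of_nat (p ^ i) * S i ^ (p ^ (n - i))) + of_nat (p ^ n) * r = w n"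
  have "\<exists>S. \<forall>n. ?P S n (S n)"
  proof (rule dependent_wellorder_choice)
    fix n and S :: "nat \<Rightarrow> int_mpoly"
    assume IH: "\<And>i. i < n \<Longrightarrow> ?P S i (S i)"
    show "\<exists>r. ?P S n r"
    proof (cases n)
      case (Suc m)
      interpret comm_ring_hom "frob_lift p" by (rule frob_lift_hom)
      have "ghost p m S = w m" using IH[of m] Suc by (simp add: ghost_split_last)
      moreover have "frob_lift p (ghost p m S) = (\<Sum>i\<le>m. of_nat (p ^ i) * frob_lift p (S i) ^ (p ^ (m - i)))"
        by (simp add: ghost_def hom_distribs)
      ultimately have "frob_lift p (w m) = (\<Sum>i\<le>m. of_nat (p ^ i) * frob_lift p (S i) ^ (p ^ (m - i)))"
        by (simp only:)
      moreover have "(\<Sum>i\<le>m. of_nat (p ^ i) * S i ^ (p ^ (n - i))) =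
          (\<Sum>i\<le>m. of_nat (p ^ i) * (S i ^ p) ^ (p ^ (m - i)))"
        using Suc by (intro sum.cong) (simp_all add: Suc_diff_le power_mult)
      ultimately have eq: "frob_lift p (w m) - (\<Sum>i\<le>m. of_nat (p ^ i) * S i ^ (p ^ (n - i))) =
          (\<Sum>i\<le>m. of_nat (p ^ i) * (frob_lift p (S i) ^ (p ^ (m - i)) - (S i ^ p) ^ (p ^ (m - i))))"
        by (simp only: sum_subtractf right_diff_distrib)
      have "of_nat (p ^ n) dvd of_nat (p ^ i) *
          (frob_lift p (S i) ^ (p ^ (m - i)) - (S i ^ p) ^ (p ^ (m - i)))" if "i \<le> m" for i
      proof -
        have "n = i + (m - i + 1)" using that Suc by simp
        then have "p ^ n = p ^ i * p ^ (m - i + 1)" by (simp only: power_add)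
        then have "(of_nat (p ^ n) :: int_mpoly) = of_nat (p ^ i) * of_nat (p ^ (m - i + 1))"
          by (simp only: of_nat_mult)
        then show ?thesis
          using power_p_dvd_diff[OF frob_lift_cong[OF p, of "S i"], of "m - i"]
          by (simp only: mult_dvd_mono dvd_refl)
      qed
      then have frob: "of_nat (p ^ n) dvd frob_lift p (w m) - (\<Sum>i\<le>m. of_nat (p ^ i) * S i ^ (p ^ (n - i)))"
        unfolding eq by (intro dvd_sum) simp
      have "of_nat (p ^ n) dvd w n - frob_lift p (w m)"
        using w Suc unfolding dwork_seq_def by blast
      from dvd_add[OF this frob]
      have "of_nat (p ^ n) dvd w n - (\<Sum>i<n. of_nat (p ^ i) * S i ^ (p ^ (n - i)))"
        using Suc by (simp add: lessThan_Suc_atMost)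
      then obtain r where "w n - (\<Sum>i<n. of_nat (p ^ i) * S i ^ (p ^ (n - i))) = of_nat (p ^ n) * r"
        by (elim dvdE)
      then show ?thesis by (intro exI[of _ r]) (simp add: algebra_simps)
    qed simp
  qed simp
  then show ?thesis by (simp add: ghost_split_last)
qed

section \<open>Witt vector operations\<close>

lemma witt_poly_unique_ex:
  assumes "Factorial_Ring.prime p" "dwork_seq p w"
  shows "\<exists>!S. \<forall>n. ghost p n S = w n"
  using dwork[OF assms] ghost_inject[OF prime_gt_0_nat[OF assms(1)]] by metis

lemma ghost_witt_sum_poly:
  assumes "Factorial_Ring.prime p"
  shows "ghost p n (witt_sum_poly p) = ghost p n (\<lambda>i. mpoly_var (Inl i)) + ghost p n (\<lambda>i. mpoly_var (Inr i))"
  unfolding witt_sum_poly_def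
  using theI'[OF witt_poly_unique_ex[OF assms dwork_seq_add[OF dwork_seq_ghost_var dwork_seq_ghost_var]]]
  by blast

lemma ghost_witt_prod_poly:
  assumes "Factorial_Ring.prime p"
  shows "ghost p n (witt_prod_poly p) = ghost p n (\<lambda>i. mpoly_var (Inl i)) * ghost p n (\<lambda>i. mpoly_var (Inr i))"
  unfolding witt_prod_poly_def
  using theI'[OF witt_poly_unique_ex[OF assms dwork_seq_mult[OF dwork_seq_ghost_var dwork_seq_ghost_var]]]
  by blast

text \<open>Additive inverses of Witt vectors are not given by negating components when \<open>p = 2\<close>, so they get
  universal polynomials of their own.\<close>

definition witt_neg_poly :: "nat \<Rightarrow> nat \<Rightarrow> int_mpoly" where
  "witt_neg_poly p = (SOME S. \<forall>n. ghost p n S = - ghost p n (\<lambda>i. mpoly_var (Inl i)))"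

lemma ghost_witt_neg_poly:
  assumes "Factorial_Ring.prime p"
  shows "ghost p n (witt_neg_poly p) = - ghost p n (\<lambda>i. mpoly_var (Inl i))"
  unfolding witt_neg_poly_def
  using someI_ex[OF dwork[OF assms dwork_seq_uminus[OF dwork_seq_ghost_var]]] by blast

definition witt_add :: "nat \<Rightarrow> (nat \<Rightarrow> 'k::comm_ring_1) \<Rightarrow> (nat \<Rightarrow> 'k) \<Rightarrow> nat \<Rightarrow> 'k" where
  "witt_add p x y n = mpoly_eval (case_sum x y) (witt_sum_poly p n)"

definition witt_mult :: "nat \<Rightarrow> (nat \<Rightarrow> 'k::comm_ring_1) \<Rightarrow> (nat \<Rightarrow> 'k) \<Rightarrow> nat \<Rightarrow> 'k" where
  "witt_mult p x y n = mpoly_eval (case_sum x y) (witt_prod_poly p n)"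

definition witt_neg :: "nat \<Rightarrow> (nat \<Rightarrow> 'k::comm_ring_1) \<Rightarrow> nat \<Rightarrow> 'k" where
  "witt_neg p x n = mpoly_eval (case_sum x x) (witt_neg_poly p n)"

lemma ghost_witt_add:
  assumes "Factorial_Ring.prime p"
  shows "ghost p n (witt_add p x y) = ghost p n x + ghost p n y"
proof -
  interpret comm_ring_hom "mpoly_eval (case_sum x y)" by (rule mpoly_eval_hom)
  have "ghost p n (witt_add p x y) = mpoly_eval (case_sum x y) (ghost p n (witt_sum_poly p))"
    by (simp add: hom_ghost witt_add_def[abs_def])
  then show ?thesis by (simp add: ghost_witt_sum_poly[OF assms] hom_distribs hom_ghost)
qed

lemma ghost_witt_mult:
  assumes "Factorial_Ring.prime p"
  shows "ghost p n (witt_mult p x y) = ghost p n x * ghost p n y"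
proof -
  interpret comm_ring_hom "mpoly_eval (case_sum x y)" by (rule mpoly_eval_hom)
  have "ghost p n (witt_mult p x y) = mpoly_eval (case_sum x y) (ghost p n (witt_prod_poly p))"
    by (simp add: hom_ghost witt_mult_def[abs_def])
  then show ?thesis by (simp add: ghost_witt_prod_poly[OF assms] hom_distribs hom_ghost)
qed

lemma ghost_witt_neg:
  assumes "Factorial_Ring.prime p"
  shows "ghost p n (witt_neg p x) = - ghost p n x"
proof -
  interpret comm_ring_hom "mpoly_eval (case_sum x x)" by (rule mpoly_eval_hom)
  have "ghost p n (witt_neg p x) = mpoly_eval (case_sum x x) (ghost p n (witt_neg_poly p))"
    by (simp add: hom_ghost witt_neg_def[abs_def])
  then show ?thesis by (simp add: ghost_witt_neg_poly[OF assms] hom_distribs hom_ghost)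
qed

lemma (in comm_ring_hom) comp_case_sum: "(\<lambda>v. hom (case_sum x y v)) = case_sum (hom \<circ> x) (hom \<circ> y)"
  by (auto split: sum.split)

lemma (in comm_ring_hom) hom_witt_add: "hom \<circ> witt_add p x y = witt_add p (hom \<circ> x) (hom \<circ> y)"
  by (simp add: fun_eq_iff witt_add_def hom_mpoly_eval comp_case_sum)

lemma (in comm_ring_hom) hom_witt_mult: "hom \<circ> witt_mult p x y = witt_mult p (hom \<circ> x) (hom \<circ> y)"
  by (simp add: fun_eq_iff witt_mult_def hom_mpoly_eval comp_case_sum)

lemma (in comm_ring_hom) hom_witt_neg: "hom \<circ> witt_neg p x = witt_neg p (hom \<circ> x)"
  by (simp add: fun_eq_iff witt_neg_def hom_mpoly_eval comp_case_sum)

text \<open>Any three Witt vectors over any ring are images of vectors over the torsion-free polynomial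
  ring, because that ring has infinitely many variables: those in the first family are split
  into even and odd indices, those in the second family serve for the third vector. Identities
  checked on ghost components over polynomials thus hold over every ring.\<close>

lemma witt_vectors_from_int_mpoly:
  fixes x y z :: "nat \<Rightarrow> 'k::comm_ring_1"
  obtains h :: "int_mpoly \<Rightarrow> 'k" and A B C
  where "comm_ring_hom h" "x = h \<circ> A" "y = h \<circ> B" "z = h \<circ> C"
proof
  let ?h = "mpoly_eval (case_sum (\<lambda>j. if even j then x (j div 2) else y (j div 2)) z)"
  show "comm_ring_hom ?h" by (rule mpoly_eval_hom)
  show "x = ?h \<circ> (\<lambda>i. mpoly_var (Inl (2 * i)))" by auto
  show "y = ?h \<circ> (\<lambda>i. mpoly_var (Inl (2 * i + 1)))" by auto
  show "z = ?h \<circ> (\<lambda>i. mpoly_var (Inr i))" by auto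
qed

lemma ghost_zero: "p > 0 \<Longrightarrow> ghost p n (\<lambda>_. 0) = 0"
  by (simp add: ghost_def zero_power)

lemma ghost_teichmueller: "p > 0 \<Longrightarrow> ghost p n (teichmueller a) = a ^ (p ^ n)"
proof -
  assume "p > 0"
  then have "ghost p n (teichmueller a) = (\<Sum>i\<le>n. if i = 0 then a ^ (p ^ n) else 0)"
    unfolding ghost_def teichmueller_def by (intro sum.cong) (auto simp: zero_power)
  then show ?thesis by simp
qed

lemma (in comm_ring_hom) hom_teichmueller: "hom \<circ> teichmueller a = teichmueller (hom a)"
  by (simp add: fun_eq_iff teichmueller_def)

lemma witt_ring_laws:
  fixes x y z :: "nat \<Rightarrow> 'k::comm_ring_1"
  assumes p: "Factorial_Ring.prime p"
  shows witt_add_assoc: "witt_add p (witt_add p x y) z = witt_add p x (witt_add p y z)"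
    and witt_add_commute: "witt_add p x y = witt_add p y x"
    and witt_add_zero: "witt_add p (\<lambda>_. 0) x = x"
    and witt_add_neg: "witt_add p (witt_neg p x) x = (\<lambda>_. 0)"
    and witt_mult_assoc: "witt_mult p (witt_mult p x y) z = witt_mult p x (witt_mult p y z)"
    and witt_mult_commute: "witt_mult p x y = witt_mult p y x"
    and witt_mult_one: "witt_mult p (teichmueller 1) x = x"
    and witt_distrib: "witt_mult p (witt_add p x y) z = witt_add p (witt_mult p x z) (witt_mult p y z)"
proof -
  obtain h :: "int_mpoly \<Rightarrow> 'k" and A B C
    where h: "comm_ring_hom h" and xyz: "x = h \<circ> A" "y = h \<circ> B" "z = h \<circ> C"
    by (rule witt_vectors_from_int_mpoly[of x y z])
  interpret comm_ring_hom h by (rule h)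
  have p0: "p > 0" using p by (rule prime_gt_0_nat)
  have zero: "(\<lambda>_. 0) = h \<circ> (\<lambda>_. 0)" and one: "teichmueller 1 = h \<circ> teichmueller 1"
    by (simp_all add: fun_eq_iff teichmueller_def)
  note ghost = ghost_witt_add[OF p] ghost_witt_mult[OF p] ghost_witt_neg[OF p]
    ghost_zero[OF p0] ghost_teichmueller[OF p0]
  note hom = hom_witt_add[symmetric] hom_witt_mult[symmetric] hom_witt_neg[symmetric]
  have "witt_add p (witt_add p A B) C = witt_add p A (witt_add p B C)"
    by (rule ghost_inject[OF p0]) (simp add: ghost)
  then show "witt_add p (witt_add p x y) z = witt_add p x (witt_add p y z)"
    by (simp only: xyz hom)
  have "witt_add p A B = witt_add p B A"
    by (rule ghost_inject[OF p0]) (simp add: ghost)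
  then show "witt_add p x y = witt_add p y x"
    by (simp only: xyz hom)
  have "witt_add p (\<lambda>_. 0) A = A"
    by (rule ghost_inject[OF p0]) (simp add: ghost)
  then show "witt_add p (\<lambda>_. 0) x = x"
    by (simp only: xyz zero hom)
  have "witt_add p (witt_neg p A) A = (\<lambda>_. 0)"
    by (rule ghost_inject[OF p0]) (simp add: ghost)
  then show "witt_add p (witt_neg p x) x = (\<lambda>_. 0)"
    by (simp only: xyz zero hom)
  have "witt_mult p (witt_mult p A B) C = witt_mult p A (witt_mult p B C)"
    by (rule ghost_inject[OF p0]) (simp add: ghost mult.assoc)
  then show "witt_mult p (witt_mult p x y) z = witt_mult p x (witt_mult p y z)"
    by (simp only: xyz hom)
  have "witt_mult p A B = witt_mult p B A"
    by (rule ghost_inject[OF p0]) (simp add: ghost mult.commute)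
  then show "witt_mult p x y = witt_mult p y x"
    by (simp only: xyz hom)
  have "witt_mult p (teichmueller 1) A = A"
    by (rule ghost_inject[OF p0]) (simp add: ghost)
  then show "witt_mult p (teichmueller 1) x = x"
    by (simp only: xyz one hom)
  have "witt_mult p (witt_add p A B) C = witt_add p (witt_mult p A C) (witt_mult p B C)"
    by (rule ghost_inject[OF p0]) (simp add: ghost distrib_right)
  then show "witt_mult p (witt_add p x y) z = witt_add p (witt_mult p x z) (witt_mult p y z)"
    by (simp only: xyz hom)
qed

text \<open>The shift \<open>(x\<^sub>0, x\<^sub>1, \<dots>) \<mapsto> (0, x\<^sub>0, x\<^sub>1, \<dots>)\<close> is the Verschiebung; on ghost components it is a shift
  multiplied by \<open>p\<close>.\<close>

lemma ghost_shift:
  assumes "p > 0"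
  shows "ghost p n (case_nat 0 x) = (case n of 0 \<Rightarrow> 0 | Suc m \<Rightarrow> of_nat p * ghost p m x)"
proof (cases n)
  case (Suc m)
  show ?thesis
    unfolding Suc ghost_def sum.atMost_Suc_shift using assms
    by (simp add: zero_power sum_distrib_left mult.assoc)
qed (simp add: ghost_def)

text \<open>The Teichmueller part and the shifted part have disjoint components, and then Witt addition simply
  juxtaposes them.\<close>

lemma witt_add_teichmueller_shift:
  fixes x :: "nat \<Rightarrow> 'k::comm_ring_1"
  assumes p: "Factorial_Ring.prime p"
  shows "witt_add p (teichmueller (x 0)) (case_nat 0 (\<lambda>n. x (Suc n))) = x"
proof -
  obtain h :: "int_mpoly \<Rightarrow> 'k" and A B C
    where h: "comm_ring_hom h" and x: "x = h \<circ> A" "x = h \<circ> B" "x = h \<circ> C"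
    by (rule witt_vectors_from_int_mpoly[of x x x])
  interpret comm_ring_hom h by (rule h)
  have p0: "p > 0" using p by (rule prime_gt_0_nat)
  have shift: "case_nat 0 (\<lambda>n. x (Suc n)) = h \<circ> case_nat 0 (\<lambda>n. A (Suc n))"
    by (auto simp: fun_eq_iff x(1) split: nat.split)
  have teich: "teichmueller (x 0) = h \<circ> teichmueller (A 0)"
    by (simp add: hom_teichmueller x(1))
  have "ghost p n A = A 0 ^ (p ^ n) + (case n of 0 \<Rightarrow> 0 | Suc m \<Rightarrow> of_nat p * ghost p m (\<lambda>n. A (Suc n)))" for n
  proof (cases n)
    case (Suc m)
    show ?thesis
      unfolding Suc ghost_def sum.atMost_Suc_shift
      by (simp add: sum_distrib_left mult.assoc)
  qed (simp add: ghost_def)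
  then have "witt_add p (teichmueller (A 0)) (case_nat 0 (\<lambda>n. A (Suc n))) = A"
    by (intro ghost_inject[OF p0])
      (simp only: ghost_witt_add[OF p] ghost_teichmueller[OF p0] ghost_shift[OF p0])
  then show ?thesis by (simp only: shift teich hom_witt_add[symmetric]) (simp only: x(1))
qed

text \<open>A version of \<open>ghost_inject\<close> modulo \<open>p\<close>: the factor \<open>p\<^sup>n\<close> in front of the \<open>n\<close>-th component costs \<open>n\<close>
  powers of \<open>p\<close>, so agreement modulo \<open>p\<^sup>n\<^sup>+\<^sup>1\<close> is needed on ghost components.\<close>

lemma ghost_cong_imp_cong:
  fixes S T :: "nat \<Rightarrow> int_mpoly"
  assumes "p > 0" and ghost: "\<And>n. of_nat (p ^ Suc n) dvd ghost p n S - ghost p n T"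
  shows "of_nat p dvd S n - T n"
proof (induction n rule: less_induct)
  case (less n)
  have "of_nat (p ^ Suc n) dvd of_nat (p ^ i) * (S i ^ (p ^ (n - i)) - T i ^ (p ^ (n - i)))" if "i < n" for i
  proof -
    have "Suc n = i + (n - i + 1)" using that by simp
    then have "p ^ Suc n = p ^ i * p ^ (n - i + 1)" by (simp only: power_add)
    then have "(of_nat (p ^ Suc n) :: int_mpoly) = of_nat (p ^ i) * of_nat (p ^ (n - i + 1))"
      by (simp only: of_nat_mult)
    then show ?thesis
      using power_p_dvd_diff[OF less[OF that], of "n - i"] by (simp only: mult_dvd_mono dvd_refl)
  qed
  then have "of_nat (p ^ Suc n) dvd (\<Sum>i<n. of_nat (p ^ i) * (S i ^ (p ^ (n - i)) - T i ^ (p ^ (n - i))))"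
    by (intro dvd_sum) simp
  from dvd_diff[OF ghost[of n] this]
  have "of_nat (p ^ n) * of_nat p dvd of_nat (p ^ n) * (S n - T n)"
    by (simp add: ghost_split_last sum_subtractf right_diff_distrib mult.commute)
  then show ?case by (rule int_mpoly_dvd_cancel) (use assms(1) in simp)
qed

lemma ghost_witt_multiple:
  assumes "Factorial_Ring.prime p"
  shows "ghost p n ((witt_add p x ^^ m) (\<lambda>_. 0)) = of_nat m * ghost p n x"
  by (induction m)
    (simp_all add: ghost_zero prime_gt_0_nat assms ghost_witt_add distrib_right)

lemma funpow_Suc_apply: "(f ^^ Suc m) z = f ((f ^^ m) z)"
  by simp

lemma (in comm_ring_hom) hom_witt_multiple:
  "hom \<circ> (witt_add p x ^^ m) (\<lambda>_. 0) = (witt_add p (hom \<circ> x) ^^ m) (\<lambda>_. 0)"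
proof (induction m)
  case (Suc m)
  show ?case unfolding funpow_Suc_apply hom_witt_add Suc ..
qed (simp add: fun_eq_iff)

text \<open>Multiplication by \<open>p\<close> is the Verschiebung of the Frobenius image. Over the polynomial ring the ghost components of the two
  sides differ by \<open>p\<^sup>n\<^sup>+\<^sup>1 x\<^sub>n\<close>, so their components agree modulo \<open>p\<close>, and this
  congruence becomes an equation in characteristic \<open>p\<close>.\<close>

lemma witt_multiple_char:
  fixes x :: "nat \<Rightarrow> 'k::comm_ring_1"
  assumes p: "Factorial_Ring.prime p" and char: "CHAR('k) = p"
  shows "(witt_add p x ^^ p) (\<lambda>_. 0) = case_nat 0 (\<lambda>n. x n ^ p)"
proof -
  obtain h :: "int_mpoly \<Rightarrow> 'k" and A B C
    where h: "comm_ring_hom h" and x: "x = h \<circ> A" "x = h \<circ> B" "x = h \<circ> C"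
    by (rule witt_vectors_from_int_mpoly[of x x x])
  interpret comm_ring_hom h by (rule h)
  have p0: "p > 0" using p by (rule prime_gt_0_nat)
  let ?S = "(witt_add p A ^^ p) (\<lambda>_. 0)" and ?T = "case_nat 0 (\<lambda>n. A n ^ p)"
  have "of_nat (p ^ Suc n) dvd ghost p n ?S - ghost p n ?T" for n
  proof (cases n)
    case 0
    then show ?thesis
      by (simp add: ghost_witt_multiple[OF p] ghost_shift[OF p0])
  next
    case (Suc m)
    have "ghost p n A = ghost p m (\<lambda>i. A i ^ p) + of_nat (p ^ n) * A n"
      unfolding Suc ghost_split_last[of p "Suc m"] lessThan_Suc_atMost ghost_def
      by (simp add: Suc_diff_le flip: power_mult)
    then have "ghost p n ?S - ghost p n ?T = of_nat (p ^ Suc n) * A n"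
      by (simp only: ghost_witt_multiple[OF p] ghost_shift[OF p0])
        (simp add: Suc algebra_simps)
    then show ?thesis by simp
  qed
  then have dvd: "of_nat p dvd ?S n - ?T n" for n
    by (rule ghost_cong_imp_cong[OF p0])
  have "h (?S n) = h (?T n)" for n
  proof -
    obtain c where c: "?S n - ?T n = of_nat p * c" using dvd by (rule dvdE)
    have "h (?S n) - h (?T n) = h (?S n - ?T n)" by (simp add: hom_distribs)
    also have "\<dots> = of_nat p * h c" unfolding c by (simp add: hom_distribs)
    also have "\<dots> = 0" by (simp flip: char)
    finally show ?thesis by simp
  qed
  then have "h \<circ> ?S = h \<circ> ?T" by auto
  moreover have "h \<circ> ?T = case_nat 0 (\<lambda>n. x n ^ p)"
    by (auto simp: fun_eq_iff x(1) hom_distribs split: nat.split)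
  ultimately show ?thesis by (simp only: hom_witt_multiple x(1))
qed

lemma witt_add_0: "Factorial_Ring.prime p \<Longrightarrow> witt_add p x y 0 = x 0 + y 0"
  using ghost_witt_add[of p 0 x y] by (simp add: ghost_def)

section \<open>Witt vectors over an algebraic closure of \<open>\<bbbF>\<^sub>p\<close>\<close>

text \<open>Packing the Witt vectors into a type of their own makes them an instance of the class of
  commutative rings, so that finite sums, divisibility and ring normalization become available.\<close>

typedef 'p witt = "UNIV :: (nat \<Rightarrow> 'p::prime_card Fp_bar) set"
  morphisms witt_coords Witt by (rule UNIV_witness)

lemmas witt_inverse [simp] = Witt_inverse[OF UNIV_I] witt_coords_inverse

lemma Witt_eq_iff [simp]: "Witt x = Witt y \<longleftrightarrow> x = y"
  by (simp add: Witt_inject)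

lemma prime_CARD: "Factorial_Ring.prime CARD('p::prime_card)"
  by (rule prime_card)

instantiation witt :: (prime_card) comm_ring_1
begin

definition "0 = Witt (\<lambda>_. 0)"
definition "1 = Witt (teichmueller 1)"
definition "x + y = Witt (witt_add CARD('a) (witt_coords x) (witt_coords y))"
definition "x * y = Witt (witt_mult CARD('a) (witt_coords x) (witt_coords y))"
definition "- x = Witt (witt_neg CARD('a) (witt_coords x))"
definition "x - y = x + - (y :: 'a witt)"

instance
proof
  fix a b c :: "'a witt"
  note defs = zero_witt_def one_witt_def plus_witt_def times_witt_def uminus_witt_def
  note laws = witt_ring_laws[OF prime_CARD[where 'p = 'a]]
  show "a + b + c = a + (b + c)" by (simp add: defs laws(1))
  show "a + b = b + a" unfolding defs by (subst laws(2)) (rule refl)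
  show "0 + a = a" by (simp add: defs laws(3))
  show "- a + a = 0" by (simp add: defs laws(4))
  show "a - b = a + - b" by (rule minus_witt_def)
  show "a * b * c = a * (b * c)" by (simp add: defs laws(5))
  show "a * b = b * a" unfolding defs by (subst laws(6)) (rule refl)
  show "1 * a = a" by (simp add: defs laws(7))
  show "(a + b) * c = a * c + b * c" by (simp add: defs laws(8))
  show "(0 :: 'a witt) \<noteq> 1"
    by (auto simp: defs teichmueller_def dest: fun_cong[where x = 0])
qed

end

lemma char_Fp_bar: "CHAR('p::prime_card Fp_bar) = CARD('p)"
  by simp

lemma of_nat_mult_witt: "of_nat m * x = Witt ((witt_add CARD('p) (witt_coords x) ^^ m) (\<lambda>_. 0))"
  for x :: "'p::prime_card witt"
proof (induction m)
  case 0
  show ?case by (simp add: zero_witt_def[symmetric])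
next
  case (Suc m)
  have "of_nat (Suc m) * x = x + of_nat m * x" by (simp add: distrib_right)
  then show ?case by (simp only: Suc plus_witt_def witt_inverse funpow.simps o_apply)
qed

lemma CARD_mult_witt: "of_nat CARD('p) * x = Witt (case_nat 0 (\<lambda>n. witt_coords x n ^ CARD('p)))"
  for x :: "'p::prime_card witt"
  by (simp only: of_nat_mult_witt witt_multiple_char[OF prime_CARD char_Fp_bar])

lemma Fp_bar_root: "\<exists>b. b ^ CARD('p) = (a :: 'p::prime_card Fp_bar)"
  using nth_root_exists[of "CARD('p)" a] prime_CARD[where 'p = 'p] by (auto simp: prime_gt_0_nat)

lemma Fp_bar_root_unique:
  fixes a b :: "'p::prime_card Fp_bar"
  assumes "a ^ CARD('p) = b ^ CARD('p)"
  shows "a = b"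
proof -
  have "((a - b) + b) ^ CARD('p) = (a - b) ^ CARD('p) + b ^ CARD('p)"
    by (rule freshmans_dream) (simp_all add: prime_CARD)
  then show ?thesis using assms by simp
qed

lemma CARD_mult_witt_cancel:
  fixes x y :: "'p::prime_card witt"
  assumes "of_nat CARD('p) * x = of_nat CARD('p) * y"
  shows "x = y"
proof -
  have eq: "case_nat 0 (\<lambda>n. witt_coords x n ^ CARD('p)) = case_nat 0 (\<lambda>n. witt_coords y n ^ CARD('p))"
    using assms unfolding CARD_mult_witt Witt_eq_iff .
  have "witt_coords x n = witt_coords y n" for n
    by (rule Fp_bar_root_unique) (use fun_cong[OF eq, of "Suc n"] in \<open>simp only: nat.case\<close>)
  then show ?thesis by (metis ext witt_inverse(2))
qed

definition witt_teich :: "'p::prime_card Fp_bar \<Rightarrow> 'p witt" where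
  "witt_teich a = Witt (teichmueller a)"

lemma witt_teich_0 [simp]: "witt_teich 0 = 0"
  by (simp add: witt_teich_def zero_witt_def teichmueller_def)

lemma witt_coord_0_add: "witt_coords (x + y) 0 = witt_coords x 0 + witt_coords y 0"
  by (simp add: plus_witt_def witt_add_0 prime_CARD)

lemma witt_coord_0_teich [simp]: "witt_coords (witt_teich a) 0 = a"
  by (simp add: witt_teich_def teichmueller_def)

lemma witt_coord_0_CARD_mult: "witt_coords (of_nat CARD('p) * x) 0 = 0" for x :: "'p::prime_card witt"
  by (simp only: CARD_mult_witt witt_inverse nat.case)

text \<open>This is where perfectness of the residue field enters: the shifted part of \<open>x\<close> is a multiple of \<open>p\<close> once
  its components are replaced by their \<open>p\<close>-th roots.\<close>

lemma witt_teich_expansion: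
  fixes x :: "'p::prime_card witt"
  shows "\<exists>y. x = witt_teich (witt_coords x 0) + of_nat CARD('p) * y"
proof -
  obtain r :: "'p Fp_bar \<Rightarrow> 'p Fp_bar" where r: "r a ^ CARD('p) = a" for a
    using Fp_bar_root by metis
  have "x = witt_teich (witt_coords x 0) +
      of_nat CARD('p) * Witt (\<lambda>n. r (witt_coords x (Suc n)))"
    unfolding CARD_mult_witt
    by (simp add: r witt_teich_def plus_witt_def witt_add_teichmueller_shift prime_CARD)
  then show ?thesis ..
qed

text \<open>The component with index 0 is additive and vanishes on multiples of \<open>p\<close>.\<close>

lemma witt_teich_cong:
  fixes a b :: "'p::prime_card Fp_bar"
  assumes "of_nat CARD('p) dvd witt_teich a - witt_teich b"
  shows "a = b"
proof -
  obtain c where "witt_teich a - witt_teich b = of_nat CARD('p) * c" using assms by (rule dvdE)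
  then have "witt_teich a = witt_teich b + of_nat CARD('p) * c" by (simp add: algebra_simps)
  then have "witt_coords (witt_teich a) 0 = witt_coords (witt_teich b) 0"
    by (simp only: witt_coord_0_add witt_coord_0_CARD_mult add_0_right)
  then show ?thesis by simp
qed

section \<open>Well-ordered sets of rationals\<close>

lemma well_ordered_iff:
  "well_ordered S \<longleftrightarrow> (\<forall>T. T \<subseteq> S \<longrightarrow> T \<noteq> {} \<longrightarrow> (\<exists>m\<in>T. \<forall>t\<in>T. m \<le> t))"
proof
  assume "well_ordered S"
  then have "wf (le_on S - Id)" by (simp add: well_ordered_def well_order_on_def)
  then show "\<forall>T. T \<subseteq> S \<longrightarrow> T \<noteq> {} \<longrightarrow> (\<exists>m\<in>T. \<forall>t\<in>T. m \<le> t)"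
  proof (intro allI impI)
    fix T assume T: "T \<subseteq> S" "T \<noteq> {}"
    then obtain x where "x \<in> T" by auto
    then obtain m where m: "m \<in> T" "\<And>y. (y, m) \<in> le_on S - Id \<Longrightarrow> y \<notin> T"
      using wfE_min[OF \<open>wf (le_on S - Id)\<close>] by metis
    have "m \<le> t" if "t \<in> T" for t
      using m(2)[of t] that T m(1) by (force simp: le_on_def)
    then show "\<exists>m\<in>T. \<forall>t\<in>T. m \<le> t" using m(1) by blast
  qed
next
  assume min: "\<forall>T. T \<subseteq> S \<longrightarrow> T \<noteq> {} \<longrightarrow> (\<exists>m\<in>T. \<forall>t\<in>T. m \<le> t)"
  have "wf (le_on S - Id)"
  proof (rule wfI_min)
    fix x :: rat and Q assume "x \<in> Q"
    show "\<exists>z\<in>Q. \<forall>y. (y, z) \<in> le_on S - Id \<longrightarrow> y \<notin> Q"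
    proof (cases "Q \<inter> S = {}")
      case True
      then show ?thesis using \<open>x \<in> Q\<close> by (auto simp: le_on_def)
    next
      case False
      then obtain m where "m \<in> Q \<inter> S" "\<forall>t\<in>Q \<inter> S. m \<le> t"
        using min by (metis inf_le2)
      then show ?thesis by (intro bexI[of _ m]) (force simp: le_on_def)+
    qed
  qed
  moreover have "linear_order_on S (le_on S)"
    unfolding order_on_defs refl_on_def trans_def antisym_def total_on_def
    by (auto simp: le_on_def)
  ultimately show "well_ordered S" by (simp add: well_ordered_def well_order_on_def)
qed

lemma well_ordered_min:
  assumes "well_ordered S" "T \<subseteq> S" "T \<noteq> {}"
  shows "\<exists>m\<in>T. \<forall>t\<in>T. m \<le> t"
  using assms unfolding well_ordered_iff by blast

lemma well_ordered_subset: "well_ordered S \<Longrightarrow> T \<subseteq> S \<Longrightarrow> well_ordered T"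
  unfolding well_ordered_iff by blast

lemma well_ordered_empty [simp]: "well_ordered {}"
  by (simp add: well_ordered_iff)

lemma well_ordered_union:
  assumes "well_ordered S" "well_ordered T"
  shows "well_ordered (S \<union> T)"
  unfolding well_ordered_iff
proof (intro allI impI)
  fix U assume U: "U \<subseteq> S \<union> T" "U \<noteq> {}"
  show "\<exists>m\<in>U. \<forall>t\<in>U. m \<le> t"
  proof (cases "U \<inter> S = {} \<or> U \<inter> T = {}")
    case True
    then have "U \<subseteq> S \<or> U \<subseteq> T" using U by blast
    then show ?thesis using assms U(2) unfolding well_ordered_iff by blast
  next
    case False
    obtain s where s: "s \<in> U \<inter> S" "\<And>u. u \<in> U \<inter> S \<Longrightarrow> s \<le> u"
      using well_ordered_min[OF assms(1), of "U \<inter> S"] False by blast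
    obtain t where t: "t \<in> U \<inter> T" "\<And>u. u \<in> U \<inter> T \<Longrightarrow> t \<le> u"
      using well_ordered_min[OF assms(2), of "U \<inter> T"] False by blast
    have "min s t \<in> U" using s t by (simp add: min_def)
    moreover have "min s t \<le> u" if "u \<in> U" for u
      using that U(1) s(2)[of u] t(2)[of u] by (auto simp: min_le_iff_disj)
    ultimately show ?thesis by blast
  qed
qed

lemma well_ordered_singleton [simp]: "well_ordered {a}"
  unfolding well_ordered_iff by (auto simp: subset_singleton_iff)

definition sumset :: "rat set \<Rightarrow> rat set \<Rightarrow> rat set" where
  "sumset A B = {a + b | a b. a \<in> A \<and> b \<in> B}"

text \<open>Suppose that \<open>T\<close> has no minimum. For \<open>t \<in> T\<close> take the least \<open>\<alpha> t\<close> that occurs as first summand of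
  an element of \<open>T\<close> below \<open>t\<close>, with a second summand \<open>\<beta> t\<close>. Passing from \<open>t\<close> to \<open>\<alpha> t + \<beta> t\<close> can only
  increase \<open>\<alpha>\<close>, while the sum decreases, so \<open>\<beta>\<close> strictly decreases; at a minimum of \<open>\<beta>\<close> this is absurd.\<close>

lemma well_ordered_sumset:
  assumes A: "well_ordered A" and B: "well_ordered B"
  shows "well_ordered (sumset A B)"
  unfolding well_ordered_iff
proof (intro allI impI, rule ccontr)
  fix T assume T: "T \<subseteq> sumset A B" "T \<noteq> {}" and no_min: "\<not> (\<exists>m\<in>T. \<forall>t\<in>T. m \<le> t)"
  define S where "S t = {a \<in> A. \<exists>b\<in>B. a + b \<in> T \<and> a + b < t}" for t
  define P where "P t a b \<longleftrightarrow> a \<in> S t \<and> (\<forall>a'\<in>S t. a \<le> a') \<and> b \<in> B \<and> a + b \<in> T \<and> a + b < t" for t a b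
  have "\<exists>a b. P t a b" if "t \<in> T" for t
  proof -
    have "\<exists>t'\<in>T. t' < t" using no_min \<open>t \<in> T\<close> by (meson not_le)
    then obtain t' where t': "t' \<in> T" "t' < t" by blast
    then obtain a b where "t' = a + b" "a \<in> A" "b \<in> B"
      using T(1) unfolding sumset_def by blast
    then have "S t \<noteq> {}" using t' unfolding S_def by blast
    moreover have "S t \<subseteq> A" unfolding S_def by blast
    ultimately obtain a where a: "a \<in> S t" "\<And>a'. a' \<in> S t \<Longrightarrow> a \<le> a'"
      using well_ordered_min[OF A] by metis
    then obtain b where "b \<in> B" "a + b \<in> T" "a + b < t" unfolding S_def by blast
    then show ?thesis using a unfolding P_def by blast
  qed
  then obtain \<alpha> \<beta> where "\<And>t. t \<in> T \<Longrightarrow> P t (\<alpha> t) (\<beta> t)"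
    by metis
  then have ab: "\<And>t. t \<in> T \<Longrightarrow> \<alpha> t \<in> S t \<and> (\<forall>a'\<in>S t. \<alpha> t \<le> a') \<and>
      \<beta> t \<in> B \<and> \<alpha> t + \<beta> t \<in> T \<and> \<alpha> t + \<beta> t < t"
    unfolding P_def by blast
  obtain t where t: "t \<in> T" "\<And>u. u \<in> T \<Longrightarrow> \<beta> t \<le> \<beta> u"
  proof -
    have "\<beta> ` T \<subseteq> B" "\<beta> ` T \<noteq> {}" using ab T(2) by blast+
    then obtain b where "b \<in> \<beta> ` T" "\<And>b'. b' \<in> \<beta> ` T \<Longrightarrow> b \<le> b'"
      using well_ordered_min[OF B] by meson
    then show ?thesis using that by blast
  qed
  define u where "u = \<alpha> t + \<beta> t"
  have u: "u \<in> T" "u < t" using ab[OF t(1)] by (auto simp: u_def)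
  have "S u \<subseteq> S t"
  proof
    fix a assume "a \<in> S u"
    then show "a \<in> S t" using u(2) unfolding S_def by (blast intro: less_trans)
  qed
  then have "\<alpha> t \<le> \<alpha> u" using ab[OF t(1)] ab[OF u(1)] by blast
  moreover have "\<alpha> u + \<beta> u < \<alpha> t + \<beta> t" using ab[OF u(1)] by (simp add: u_def)
  ultimately show False using t(2)[OF u(1)] by linarith
qed

text \<open>Otherwise there is a least element with infinitely many elements below it; its immediate
  predecessor, which exists because nonempty subsets have maxima, would be a smaller one.\<close>

lemma finite_if_well_ordered_both_ways:
  assumes up: "well_ordered D" and down: "well_ordered (uminus ` D)"
  shows "finite D"
proof (cases "D = {}")
  case False
  have max: "\<exists>m\<in>T. \<forall>t\<in>T. t \<le> m" if "T \<subseteq> D" "T \<noteq> {}" for T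
  proof -
    have "uminus ` T \<subseteq> uminus ` D" "uminus ` T \<noteq> {}" using that by auto
    then obtain m where "m \<in> uminus ` T" "\<And>t. t \<in> uminus ` T \<Longrightarrow> m \<le> t"
      using well_ordered_min[OF down] by meson
    then have "- m \<in> T" "\<forall>t\<in>T. t \<le> - m" by force+
    then show ?thesis by blast
  qed
  have "finite {e \<in> D. e \<le> d}" if "d \<in> D" for d
  proof (rule ccontr)
    assume "infinite {e \<in> D. e \<le> d}"
    then have "{d \<in> D. infinite {e \<in> D. e \<le> d}} \<noteq> {}" using that by blast
    then obtain m where m: "m \<in> D" "infinite {e \<in> D. e \<le> m}"
      and least: "\<And>t. t \<in> D \<Longrightarrow> infinite {e \<in> D. e \<le> t} \<Longrightarrow> m \<le> t"
      using well_ordered_min[OF up, of "{d \<in> D. infinite {e \<in> D. e \<le> d}}"] by blast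
    have "{e \<in> D. e \<le> m} = insert m {e \<in> D. e < m}" using m(1) by auto
    with m(2) have inf: "infinite {e \<in> D. e < m}" by simp
    then have "{e \<in> D. e < m} \<noteq> {}" by (metis finite.emptyI)
    then obtain m' where m': "m' \<in> D" "m' < m" "\<And>e. e \<in> D \<Longrightarrow> e < m \<Longrightarrow> e \<le> m'"
      using max[of "{e \<in> D. e < m}"] by blast
    then have "{e \<in> D. e < m} \<subseteq> {e \<in> D. e \<le> m'}" by auto
    then have "infinite {e \<in> D. e \<le> m'}" using inf finite_subset by blast
    then show False using least[OF m'(1)] m'(2) by simp
  qed
  moreover obtain m where m: "m \<in> D" "\<forall>t\<in>D. t \<le> m" using max[OF subset_refl False] by blast
  ultimately have "finite {e \<in> D. e \<le> m}" by blast
  moreover have "{e \<in> D. e \<le> m} = D" using m by blast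
  ultimately show ?thesis by simp
qed simp

text \<open>The summands from \<open>A\<close> inherit a well-ordering from \<open>A\<close> and the reverse one from \<open>B\<close>.\<close>

lemma finite_sum_decompositions:
  assumes A: "well_ordered A" and B: "well_ordered B"
  shows "finite {a \<in> A. q - a \<in> B}"
proof (rule finite_if_well_ordered_both_ways)
  show "well_ordered {a \<in> A. q - a \<in> B}" by (rule well_ordered_subset[OF A]) auto
  have "uminus ` {a \<in> A. q - a \<in> B} \<subseteq> sumset {- q} B"
  proof
    fix y assume "y \<in> uminus ` {a \<in> A. q - a \<in> B}"
    then obtain a where "y = - q + (q - a)" "q - a \<in> B" by auto
    then show "y \<in> sumset {- q} B" unfolding sumset_def by blast
  qed
  then show "well_ordered (uminus ` {a \<in> A. q - a \<in> B})"
    by (rule well_ordered_subset[OF well_ordered_sumset[OF well_ordered_singleton B]])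
qed

lemma well_ordered_int_bound:
  assumes "well_ordered S"
  shows "\<exists>n::nat. \<forall>m>n. q - of_nat m \<notin> S"
proof (cases "S = {}")
  case False
  then obtain s where s: "\<And>t. t \<in> S \<Longrightarrow> s \<le> t"
    using well_ordered_min[OF assms subset_refl False] by blast
  obtain n :: nat where n: "q - s < of_nat n" using reals_Archimedean2 by blast
  have "q - of_nat m \<notin> S" if "m > n" for m
  proof
    assume "q - of_nat m \<in> S"
    from s[OF this] have "of_nat m \<le> q - s" by simp
    moreover have "(of_nat n :: rat) < of_nat m" using that by simp
    ultimately show False using n by linarith
  qed
  then show ?thesis by blast
qed simp

section \<open>The convolution product\<close>

definition conv :: "(rat \<Rightarrow> 'w::comm_ring_1) \<Rightarrow> (rat \<Rightarrow> 'w) \<Rightarrow> rat \<Rightarrow> 'w" where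
  "conv f g q = (\<Sum>a\<in>{a. f a \<noteq> 0 \<and> g (q - a) \<noteq> 0}. f a * g (q - a))"

definition supp :: "(rat \<Rightarrow> 'w::zero) \<Rightarrow> rat set" where
  "supp f = {q. f q \<noteq> 0}"

lemma conv_superset:
  assumes "finite D" "{a. f a \<noteq> 0 \<and> g (q - a) \<noteq> 0} \<subseteq> D"
  shows "conv f g q = (\<Sum>a\<in>D. f a * g (q - a))"
  unfolding conv_def using assms by (intro sum.mono_neutral_left) auto

lemma finite_conv_index:
  assumes "well_ordered (supp f)" "well_ordered (supp g)"
  shows "finite {a. f a \<noteq> 0 \<and> g (q - a) \<noteq> 0}"
  using finite_sum_decompositions[OF assms, of q] by (simp add: supp_def)

lemma supp_conv: "supp (conv f g) \<subseteq> sumset (supp f) (supp g)"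
proof
  fix q assume "q \<in> supp (conv f g)"
  then have "{a. f a \<noteq> 0 \<and> g (q - a) \<noteq> 0} \<noteq> {}"
    unfolding supp_def conv_def by (metis (mono_tags, lifting) mem_Collect_eq sum.empty)
  then obtain a where "f a \<noteq> 0" "g (q - a) \<noteq> 0" by blast
  then have "a \<in> supp f" "q - a \<in> supp g" "q = a + (q - a)" by (simp_all add: supp_def)
  then show "q \<in> sumset (supp f) (supp g)" unfolding sumset_def by blast
qed

lemma well_ordered_supp_conv:
  "well_ordered (supp f) \<Longrightarrow> well_ordered (supp g) \<Longrightarrow> well_ordered (supp (conv f g))"
  by (rule well_ordered_subset[OF well_ordered_sumset supp_conv])

lemma well_ordered_supp_add:
  fixes f g :: "rat \<Rightarrow> 'w::comm_ring_1"
  assumes "well_ordered (supp f)" "well_ordered (supp g)"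
  shows "well_ordered (supp (\<lambda>q. f q + g q))"
  by (rule well_ordered_subset[OF well_ordered_union[OF assms]]) (auto simp: supp_def)

lemma well_ordered_supp_uminus [simp]:
  fixes f :: "rat \<Rightarrow> 'w::comm_ring_1"
  shows "well_ordered (supp (\<lambda>q. - f q)) \<longleftrightarrow> well_ordered (supp f)"
  by (simp add: supp_def)

lemma conv_commute: "conv f g = conv g f"
proof
  fix q
  show "conv f g q = conv g f q"
    unfolding conv_def
    by (rule sum.reindex_bij_witness[where i = "\<lambda>a. q - a" and j = "\<lambda>a. q - a"])
      (auto simp: mult.commute)
qed

lemma conv_add_left:
  assumes "well_ordered (supp f)" "well_ordered (supp g)" "well_ordered (supp h)"
  shows "conv (\<lambda>q. f q + g q) h = (\<lambda>q. conv f h q + conv g h q)"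
proof
  fix q
  let ?D = "{a. f a \<noteq> 0 \<and> h (q - a) \<noteq> 0} \<union> {a. g a \<noteq> 0 \<and> h (q - a) \<noteq> 0}"
  have D: "finite ?D" using finite_conv_index assms by blast
  have "conv (\<lambda>q. f q + g q) h q = (\<Sum>a\<in>?D. (f a + g a) * h (q - a))"
    by (rule conv_superset[OF D]) auto
  also have "\<dots> = (\<Sum>a\<in>?D. f a * h (q - a)) + (\<Sum>a\<in>?D. g a * h (q - a))"
    by (simp only: distrib_right sum.distrib)
  also have "(\<Sum>a\<in>?D. f a * h (q - a)) = conv f h q"
    by (rule conv_superset[OF D, symmetric]) auto
  also have "(\<Sum>a\<in>?D. g a * h (q - a)) = conv g h q"
    by (rule conv_superset[OF D, symmetric]) auto
  finally show "conv (\<lambda>q. f q + g q) h q = conv f h q + conv g h q" .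
qed

text \<open>Writing the twofold product as a sum over pairs makes its symmetry visible; associativity
  follows from it by commutativity and a change of indices.\<close>

lemma conv_conv_eq_sum:
  assumes f: "well_ordered (supp f)" and g: "well_ordered (supp g)" and h: "well_ordered (supp h)"
  shows "conv (conv f g) h q =
    (\<Sum>(a, b)\<in>{(a, b). f a \<noteq> 0 \<and> g b \<noteq> 0 \<and> h (q - a - b) \<noteq> 0}. f a * g b * h (q - a - b))"
proof -
  let ?S = "{s \<in> sumset (supp f) (supp g). q - s \<in> supp h}"
  let ?I = "\<lambda>s. {a. f a \<noteq> 0 \<and> g (s - a) \<noteq> 0}"
  have S: "finite ?S" by (rule finite_sum_decompositions[OF well_ordered_sumset[OF f g] h])
  have "conv (conv f g) h q = (\<Sum>s\<in>?S. conv f g s * h (q - s))"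
    using supp_conv[of f g] by (intro conv_superset[OF S]) (auto simp: supp_def)
  also have "\<dots> = (\<Sum>s\<in>?S. \<Sum>a\<in>?I s. f a * g (s - a) * h (q - s))"
    by (simp add: conv_def sum_distrib_right)
  also have "\<dots> = (\<Sum>(s, a)\<in>Sigma ?S ?I. f a * g (s - a) * h (q - s))"
    using S finite_conv_index[OF f g] by (intro sum.Sigma) auto
  also have "\<dots> = (\<Sum>(a, b)\<in>{(a, b). f a \<noteq> 0 \<and> g b \<noteq> 0 \<and> h (q - a - b) \<noteq> 0}. f a * g b * h (q - a - b))"
    by (rule sum.reindex_bij_witness[where i = "\<lambda>(a, b). (a + b, a)" and j = "\<lambda>(s, a). (a, s - a)"])
      (auto simp: supp_def sumset_def diff_diff_eq)
  finally show ?thesis .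
qed

lemma conv_assoc:
  assumes f: "well_ordered (supp f)" and g: "well_ordered (supp g)" and h: "well_ordered (supp h)"
  shows "conv (conv f g) h = conv f (conv g h)"
proof
  fix q
  have "conv f (conv g h) q = conv (conv g h) f q"
    by (subst conv_commute) (rule refl)
  also have "\<dots> = (\<Sum>(b, c)\<in>{(b, c). g b \<noteq> 0 \<and> h c \<noteq> 0 \<and> f (q - b - c) \<noteq> 0}. g b * h c * f (q - b - c))"
    by (rule conv_conv_eq_sum[OF g h f])
  also have "\<dots> = (\<Sum>(a, b)\<in>{(a, b). f a \<noteq> 0 \<and> g b \<noteq> 0 \<and> h (q - a - b) \<noteq> 0}. f a * g b * h (q - a - b))"
    by (rule sum.reindex_bij_witness[where i = "\<lambda>(a, b). (b, q - a - b)" and j = "\<lambda>(b, c). (q - b - c, b)"])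
      (auto simp: algebra_simps)
  also have "\<dots> = conv (conv f g) h q"
    by (rule conv_conv_eq_sum[OF f g h, symmetric])
  finally show "conv (conv f g) h q = conv f (conv g h) q" ..
qed

definition single_term :: "'w::zero \<Rightarrow> rat \<Rightarrow> rat \<Rightarrow> 'w" where
  "single_term w s = (\<lambda>q. if q = s then w else 0)"

lemma well_ordered_supp_single_term [simp]: "well_ordered (supp (single_term w s))"
  by (rule well_ordered_subset[OF well_ordered_singleton[of s]]) (auto simp: supp_def single_term_def)

lemma conv_single_term: "conv (single_term w s) g = (\<lambda>q. w * g (q - s))"
proof
  fix q
  have "conv (single_term w s) g q = (\<Sum>a\<in>{s}. single_term w s a * g (q - a))"
    by (rule conv_superset) (auto simp: single_term_def)
  then show "conv (single_term w s) g q = w * g (q - s)" by (simp add: single_term_def)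
qed

section \<open>Null series\<close>

text \<open>The quotient by null series and the standard expansions depend only on these properties of the
  Witt vectors: \<open>\<pi>\<close> is not a zero divisor, and \<open>t\<close> picks exactly one representative in each
  residue class modulo \<open>\<pi>\<close>, zero being represented by zero.\<close>

locale digit_system =
  fixes t :: "'k::zero \<Rightarrow> 'w::comm_ring_1" and \<pi> :: 'w
  assumes cancel: "\<pi> * x = \<pi> * y \<Longrightarrow> x = y"
    and digit_zero [simp]: "t 0 = 0"
    and digit_exists: "\<exists>a y. x = t a + \<pi> * y"
    and digit_unique: "\<pi> dvd t a - t b \<Longrightarrow> a = b"
begin

lemma power_cancel: "\<pi> ^ d * x = \<pi> ^ d * y \<Longrightarrow> x = y"
  by (induction d) (auto simp: mult.assoc dest: cancel)

lemma power_dvd_cancel: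
  assumes "\<pi> ^ (K + d) dvd \<pi> ^ d * s"
  shows "\<pi> ^ K dvd s"
proof -
  obtain c where "\<pi> ^ d * s = \<pi> ^ (K + d) * c" using assms by (rule dvdE)
  then have "\<pi> ^ d * s = \<pi> ^ d * (\<pi> ^ K * c)" by (simp only: power_add mult_ac)
  then have "s = \<pi> ^ K * c" by (rule power_cancel)
  then show ?thesis by simp
qed

text \<open>A series \<open>\<Sum>i. \<pi>\<^sup>i a\<^sub>i\<close> with sum zero, expressed by its partial sums: the tail
  from index \<open>K\<close> on is divisible by \<open>\<pi>\<^sup>K\<close>, so the partial sum up to \<open>K\<close> must be divisible too.\<close>

definition vanishing :: "(nat \<Rightarrow> 'w) \<Rightarrow> bool" where
  "vanishing a \<longleftrightarrow> (\<forall>K. \<pi> ^ K dvd (\<Sum>i<K. \<pi> ^ i * a i))"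

lemma sum_leading_zeros:
  assumes "\<And>i. i < d \<Longrightarrow> a i = 0"
  shows "(\<Sum>i<K + d. \<pi> ^ i * a i) = \<pi> ^ d * (\<Sum>i<K. \<pi> ^ i * a (i + d))"
proof -
  have "(\<Sum>i<K + d. \<pi> ^ i * a i) = (\<Sum>i<d. \<pi> ^ i * a i) + (\<Sum>i<K. \<pi> ^ (i + d) * a (i + d))"
    by (induction K) simp_all
  also have "(\<Sum>i<d. \<pi> ^ i * a i) = 0" using assms by simp
  finally show ?thesis by (simp add: sum_distrib_left power_add mult_ac)
qed

lemma vanishing_leading_zeros:
  assumes zero: "\<And>i. i < d \<Longrightarrow> a i = 0"
  shows "vanishing a \<longleftrightarrow> vanishing (\<lambda>i. a (i + d))"
proof
  assume a: "vanishing a"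
  have "\<pi> ^ (K + d) dvd \<pi> ^ d * (\<Sum>i<K. \<pi> ^ i * a (i + d))" for K
  proof -
    have eq: "(\<Sum>i<K + d. \<pi> ^ i * a i) = \<pi> ^ d * (\<Sum>i<K. \<pi> ^ i * a (i + d))"
      by (rule sum_leading_zeros) (rule zero)
    have "\<pi> ^ (K + d) dvd (\<Sum>i<K + d. \<pi> ^ i * a i)" using a unfolding vanishing_def by blast
    then show ?thesis by (simp only: eq)
  qed
  then show "vanishing (\<lambda>i. a (i + d))"
    unfolding vanishing_def using power_dvd_cancel by blast
next
  assume a: "vanishing (\<lambda>i. a (i + d))"
  show "vanishing a"
    unfolding vanishing_def
  proof
    fix K
    show "\<pi> ^ K dvd (\<Sum>i<K. \<pi> ^ i * a i)"
    proof (cases "K \<le> d")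
      case True
      then show ?thesis using zero by simp
    next
      case False
      then have K: "K = (K - d) + d" by simp
      have "\<pi> ^ d * \<pi> ^ (K - d) dvd \<pi> ^ d * (\<Sum>i<K - d. \<pi> ^ i * a (i + d))"
        using a unfolding vanishing_def by (intro mult_dvd_mono) auto
      moreover have "\<pi> ^ K = \<pi> ^ d * \<pi> ^ (K - d)"
        using False by (simp only: power_add[symmetric]) simp
      moreover have "(\<Sum>i<K. \<pi> ^ i * a i) = \<pi> ^ d * (\<Sum>i<K - d. \<pi> ^ i * a (i + d))"
        by (subst K) (rule sum_leading_zeros, rule zero)
      ultimately show ?thesis by (simp only:)
    qed
  qed
qed

lemma vanishing_add: "vanishing a \<Longrightarrow> vanishing b \<Longrightarrow> vanishing (\<lambda>i. a i + b i)"
  by (simp add: vanishing_def distrib_left sum.distrib dvd_add)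

lemma vanishing_uminus: "vanishing a \<Longrightarrow> vanishing (\<lambda>i. - a i)"
  by (simp add: vanishing_def sum_negf)

lemma vanishing_iff_tends_to_zero:
  "vanishing a \<longleftrightarrow> (\<forall>M. \<exists>K0. \<forall>K\<ge>K0. \<pi> ^ M dvd (\<Sum>i<K. \<pi> ^ i * a i))"
proof
  assume "vanishing a"
  then have "\<pi> ^ M dvd (\<Sum>i<K. \<pi> ^ i * a i)" if "K \<ge> M" for M K
    using that unfolding vanishing_def by (blast intro: dvd_trans le_imp_power_dvd)
  then show "\<forall>M. \<exists>K0. \<forall>K\<ge>K0. \<pi> ^ M dvd (\<Sum>i<K. \<pi> ^ i * a i)" by blast
next
  assume lim: "\<forall>M. \<exists>K0. \<forall>K\<ge>K0. \<pi> ^ M dvd (\<Sum>i<K. \<pi> ^ i * a i)"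
  show "vanishing a"
    unfolding vanishing_def
  proof
    fix K
    obtain K0 where "\<forall>L\<ge>K0. \<pi> ^ K dvd (\<Sum>i<L. \<pi> ^ i * a i)" using lim by blast
    then have dvd: "\<pi> ^ K dvd (\<Sum>i<K + K0. \<pi> ^ i * a i)" by simp
    have "(\<Sum>i<K + d. \<pi> ^ i * a i) = (\<Sum>i<K. \<pi> ^ i * a i) + (\<Sum>i<d. \<pi> ^ (K + i) * a (K + i))" for d
      by (induction d) (simp_all add: add_ac)
    moreover have "\<pi> ^ K dvd (\<Sum>i<K0. \<pi> ^ (K + i) * a (K + i))"
      by (intro dvd_sum dvd_mult2) (simp add: power_add)
    ultimately show "\<pi> ^ K dvd (\<Sum>i<K. \<pi> ^ i * a i)"
      using dvd by (simp only: dvd_add_left_iff)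
  qed
qed

text \<open>On each coset \<open>q + \<int>\<close> the sum may be started at any point below the support; the existential
  quantifier over \<open>m\<close> could as well be universal (\<open>null_vanishing\<close>), because leading zeros do not
  matter.\<close>

definition null :: "(rat \<Rightarrow> 'w) \<Rightarrow> bool" where
  "null f \<longleftrightarrow> (\<forall>q. \<exists>m::nat. (\<forall>n>m. f (q - of_nat n) = 0) \<and> vanishing (\<lambda>i. f (q - of_nat m + of_nat i)))"

lemma null_vanishing:
  assumes f: "null f" and m: "\<And>n. n > m \<Longrightarrow> f (q - of_nat n) = 0"
  shows "vanishing (\<lambda>i. f (q - of_nat m + of_nat i))"
proof -
  obtain m' where m': "\<And>n. n > m' \<Longrightarrow> f (q - of_nat n) = 0"
    and van: "vanishing (\<lambda>i. f (q - of_nat m' + of_nat i))"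
    using f unfolding null_def by blast
  have step: "vanishing (\<lambda>i. f (q - of_nat (k + d) + of_nat i)) \<longleftrightarrow> vanishing (\<lambda>i. f (q - of_nat k + of_nat i))"
    if k: "\<And>n. n > k \<Longrightarrow> f (q - of_nat n) = 0" for k d
  proof -
    have "f (q - of_nat (k + d) + of_nat i) = 0" if "i < d" for i
    proof -
      have eq: "q - of_nat (k + d) + of_nat i = q - of_nat (k + d - i)"
        using that by (simp add: of_nat_diff)
      show ?thesis unfolding eq by (rule k) (use that in simp)
    qed
    then have "vanishing (\<lambda>i. f (q - of_nat (k + d) + of_nat i)) \<longleftrightarrow>
        vanishing (\<lambda>i. f (q - of_nat (k + d) + of_nat (i + d)))"
      by (rule vanishing_leading_zeros)
    then show ?thesis by (simp add: algebra_simps)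
  qed
  show ?thesis
  proof (cases "m \<le> m'")
    case True
    then obtain d where "m' = m + d" using that[of "m' - m"] by simp
    moreover have "vanishing (\<lambda>i. f (q - of_nat (m + d) + of_nat i)) \<longleftrightarrow> vanishing (\<lambda>i. f (q - of_nat m + of_nat i))"
      by (rule step) (rule m)
    ultimately show ?thesis using van by simp
  next
    case False
    then obtain d where "m = m' + d" using that[of "m - m'"] by simp
    moreover have "vanishing (\<lambda>i. f (q - of_nat (m' + d) + of_nat i)) \<longleftrightarrow> vanishing (\<lambda>i. f (q - of_nat m' + of_nat i))"
      by (rule step) (rule m')
    ultimately show ?thesis using van by simp
  qed
qed

lemma null_add:
  assumes f: "null f" and g: "null g"
  shows "null (\<lambda>q. f q + g q)"
  unfolding null_def
proof
  fix q
  obtain k where k: "\<And>n. n > k \<Longrightarrow> f (q - of_nat n) = 0" using f unfolding null_def by blast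
  obtain l where l: "\<And>n. n > l \<Longrightarrow> g (q - of_nat n) = 0" using g unfolding null_def by blast
  define m where "m = max k l"
  have "vanishing (\<lambda>i. f (q - of_nat m + of_nat i) + g (q - of_nat m + of_nat i))"
    by (intro vanishing_add null_vanishing f g) (simp_all add: m_def k l)
  then show "\<exists>m. (\<forall>n>m. f (q - of_nat n) + g (q - of_nat n) = 0) \<and>
      vanishing (\<lambda>i. f (q - of_nat m + of_nat i) + g (q - of_nat m + of_nat i))"
    by (intro exI[of _ m]) (simp add: m_def k l)
qed

lemma null_uminus:
  assumes "null f"
  shows "null (\<lambda>q. - f q)"
  unfolding null_def
proof
  fix q
  obtain m where "\<forall>n>m. f (q - of_nat n) = 0" "vanishing (\<lambda>i. f (q - of_nat m + of_nat i))"
    using assms unfolding null_def by blast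
  then show "\<exists>m. (\<forall>n>m. - f (q - of_nat n) = 0) \<and> vanishing (\<lambda>i. - f (q - of_nat m + of_nat i))"
    by (intro exI[of _ m] conjI vanishing_uminus) simp_all
qed

lemma null_zero: "null (\<lambda>q. 0)"
  by (simp add: null_def vanishing_def)

text \<open>The value on a coset of a product \<open>f g\<close> is formally the sum over \<open>a\<close> of \<open>f(a)\<close> times the value of \<open>g\<close>
  on a coset shifted by \<open>a\<close>, which is zero. Modulo \<open>\<pi>\<^sup>K\<close> only finitely many exponents \<open>a\<close>
  matter, since the support of \<open>f g\<close> is bounded below on the coset and each exponent has finitely many
  decompositions; so the interchange of summations is one of finite sums.\<close>

lemma null_conv:
  assumes f: "well_ordered (supp f)" and g: "well_ordered (supp g)" and null: "null g"
  shows "null (conv f g)"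
  unfolding null_def
proof
  fix q
  have F: "well_ordered (sumset (supp f) (supp g))" by (rule well_ordered_sumset[OF f g])
  obtain m where m: "\<And>n. n > m \<Longrightarrow> q - of_nat n \<notin> sumset (supp f) (supp g)"
    using well_ordered_int_bound[OF F] by blast
  have zero: "conv f g (q - of_nat n) = 0" if "n > m" for n
    using m[OF that] supp_conv[of f g] by (auto simp: supp_def)
  have "\<pi> ^ K dvd (\<Sum>i<K. \<pi> ^ i * conv f g (q - of_nat m + of_nat i))" for K
  proof -
    define A where "A = {a. f a \<noteq> 0 \<and> (\<exists>i<int K. g (q - of_nat m + of_int i - a) \<noteq> 0)}"
    have "A \<subseteq> (\<Union>i\<in>{0..<int K}. {a. f a \<noteq> 0 \<and> g (q - of_nat m + of_int i - a) \<noteq> 0})"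
    proof
      fix a assume "a \<in> A"
      then obtain i where i: "f a \<noteq> 0" "i < int K" "g (q - of_nat m + of_int i - a) \<noteq> 0"
        unfolding A_def by blast
      have "i \<ge> 0"
      proof (rule ccontr)
        assume "\<not> i \<ge> 0"
        then obtain n where n: "i = - int n" "n > 0" using that[of "nat (- i)"] by simp
        have "q - of_nat (m + n) = a + (q - of_nat m + of_int i - a)" by (simp add: n(1))
        then have "q - of_nat (m + n) \<in> sumset (supp f) (supp g)"
          using i unfolding sumset_def supp_def by blast
        then show False using m[of "m + n"] n(2) by simp
      qed
      then show "a \<in> (\<Union>i\<in>{0..<int K}. {a. f a \<noteq> 0 \<and> g (q - of_nat m + of_int i - a) \<noteq> 0})"
        using i by auto
    qed
    moreover have "finite (\<Union>i\<in>{0..<int K}. {a. f a \<noteq> 0 \<and> g (q - of_nat m + of_int i - a) \<noteq> 0})"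
      using finite_conv_index[OF f g] by blast
    ultimately have A: "finite A" by (rule finite_subset)
    have "\<exists>n. \<forall>k>n. g (q - of_nat m - a - of_nat k) = 0" for a
      using well_ordered_int_bound[OF g, of "q - of_nat m - a"] by (simp add: supp_def)
    then obtain N where N: "\<And>a k. k > N a \<Longrightarrow> g (q - of_nat m - a - of_nat k) = 0"
      by metis
    \<comment> \<open>a common starting point below the support of \<open>g\<close> on all the cosets that are involved\<close>
    define M where "M = (\<Sum>a\<in>A. N a)"
    have NM: "N a \<le> M" if "a \<in> A" for a
      unfolding M_def using that A by (simp add: member_le_sum)
    have conv_A: "conv f g (q - of_nat (m + M) + of_nat j) =
        (\<Sum>a\<in>A. f a * g (q - of_nat m - a - of_nat M + of_nat j))" if "j < K + M" for j
    proof -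
      have "{a. f a \<noteq> 0 \<and> g (q - of_nat (m + M) + of_nat j - a) \<noteq> 0} \<subseteq> A"
      proof
        fix a assume a: "a \<in> {a. f a \<noteq> 0 \<and> g (q - of_nat (m + M) + of_nat j - a) \<noteq> 0}"
        have "q - of_nat (m + M) + of_nat j - a = q - of_nat m + of_int (int j - int M) - a" by simp
        with a have "f a \<noteq> 0" "g (q - of_nat m + of_int (int j - int M) - a) \<noteq> 0"
          by (simp_all only: mem_Collect_eq simp_thms)
        moreover have "int j - int M < int K" using that by simp
        ultimately show "a \<in> A" unfolding A_def by blast
      qed
      then have "conv f g (q - of_nat (m + M) + of_nat j) =
          (\<Sum>a\<in>A. f a * g (q - of_nat (m + M) + of_nat j - a))"
        by (rule conv_superset[OF A])
      also have "\<dots> = (\<Sum>a\<in>A. f a * g (q - of_nat m - a - of_nat M + of_nat j))"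
        by (simp add: algebra_simps)
      finally show ?thesis .
    qed
    have "(\<Sum>j<K + M. \<pi> ^ j * conv f g (q - of_nat (m + M) + of_nat j)) =
        (\<Sum>j<K + M. \<Sum>a\<in>A. f a * (\<pi> ^ j * g (q - of_nat m - a - of_nat M + of_nat j)))"
    proof (rule sum.cong[OF refl])
      fix j assume "j \<in> {..<K + M}"
      then have "conv f g (q - of_nat (m + M) + of_nat j) =
          (\<Sum>a\<in>A. f a * g (q - of_nat m - a - of_nat M + of_nat j))"
        using conv_A by blast
      then show "\<pi> ^ j * conv f g (q - of_nat (m + M) + of_nat j) =
          (\<Sum>a\<in>A. f a * (\<pi> ^ j * g (q - of_nat m - a - of_nat M + of_nat j)))"
        by (simp only: sum_distrib_left) (rule sum.cong[OF refl], rule mult.left_commute)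
    qed
    also have "\<dots> = (\<Sum>a\<in>A. f a * (\<Sum>j<K + M. \<pi> ^ j * g (q - of_nat m - a - of_nat M + of_nat j)))"
      by (subst sum.swap) (simp only: sum_distrib_left)
    finally have eq: "(\<Sum>j<K + M. \<pi> ^ j * conv f g (q - of_nat (m + M) + of_nat j)) =
        (\<Sum>a\<in>A. f a * (\<Sum>j<K + M. \<pi> ^ j * g (q - of_nat m - a - of_nat M + of_nat j)))" .
    have "vanishing (\<lambda>j. g (q - of_nat m - a - of_nat M + of_nat j))" if "a \<in> A" for a
      by (rule null_vanishing[OF null]) (use N NM[OF that] in simp)
    then have "\<pi> ^ (K + M) dvd (\<Sum>j<K + M. \<pi> ^ j * g (q - of_nat m - a - of_nat M + of_nat j))"
      if "a \<in> A" for a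
      using that unfolding vanishing_def by blast
    then have "\<pi> ^ (K + M) dvd (\<Sum>j<K + M. \<pi> ^ j * conv f g (q - of_nat (m + M) + of_nat j))"
      unfolding eq by (intro dvd_sum) (rule dvd_mult)
    also have "(\<Sum>j<K + M. \<pi> ^ j * conv f g (q - of_nat (m + M) + of_nat j)) =
        \<pi> ^ M * (\<Sum>i<K. \<pi> ^ i * conv f g (q - of_nat (m + M) + of_nat (i + M)))"
    proof (rule sum_leading_zeros)
      fix i assume "i < M"
      then have eq: "q - of_nat (m + M) + of_nat i = q - of_nat (m + M - i)" by (simp add: of_nat_diff)
      show "conv f g (q - of_nat (m + M) + of_nat i) = 0"
        unfolding eq by (rule zero) (use \<open>i < M\<close> in simp)
    qed
    finally have "\<pi> ^ K dvd (\<Sum>i<K. \<pi> ^ i * conv f g (q - of_nat (m + M) + of_nat (i + M)))"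
      by (rule power_dvd_cancel)
    then show ?thesis by (simp add: algebra_simps)
  qed
  then have "vanishing (\<lambda>i. conv f g (q - of_nat m + of_nat i))"
    unfolding vanishing_def by (rule allI)
  then show "\<exists>m. (\<forall>n>m. conv f g (q - of_nat n) = 0) \<and>
      vanishing (\<lambda>i. conv f g (q - of_nat m + of_nat i))"
    using zero by (intro exI[of _ m]) simp
qed

text \<open>This is the relation \<open>t\<^sup>N = \<pi>\<^sup>N\<close> of the quotient. On each coset the two sums agree up to a shift of
  the summation index, so that only \<open>N\<close> terms at the end are left.\<close>

lemma null_shift:
  assumes f: "well_ordered (supp f)"
  shows "null (\<lambda>q. \<pi> ^ N * f q - f (q - of_nat N))"
  unfolding null_def
proof
  fix q
  obtain m where "\<And>n. n > m \<Longrightarrow> q - of_nat n \<notin> supp f"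
    using well_ordered_int_bound[OF f] by blast
  then have zero: "f (q - of_nat n) = 0" if "n > m" for n
    using that by (simp add: supp_def)
  have zero': "f (q - of_nat n - of_nat N) = 0" if "n > m" for n
    using zero[of "n + N"] that by (simp add: diff_diff_eq)
  define a where "a i = f (q - of_nat m + of_nat i - of_nat N)" for i
  have a0: "a i = 0" if "i < N" for i
  proof -
    have eq: "q - of_nat m + of_nat i - of_nat N = q - of_nat (m + N - i)"
      using that by (simp add: of_nat_diff)
    show ?thesis unfolding a_def eq by (rule zero) (use that in simp)
  qed
  have aN: "a (i + N) = f (q - of_nat m + of_nat i)" for i
  proof -
    have "q - of_nat m + of_nat (i + N) - of_nat N = q - of_nat m + of_nat i" by simp
    then show ?thesis by (simp only: a_def)
  qed
  have "vanishing (\<lambda>i. \<pi> ^ N * a (i + N) - a i)"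
    unfolding vanishing_def
  proof
    fix K
    have "(\<Sum>i<K. \<pi> ^ i * (\<pi> ^ N * a (i + N) - a i)) =
        \<pi> ^ N * (\<Sum>i<K. \<pi> ^ i * a (i + N)) - (\<Sum>i<K. \<pi> ^ i * a i)"
      by (simp add: right_diff_distrib sum_subtractf sum_distrib_left mult_ac)
    also have "\<pi> ^ N * (\<Sum>i<K. \<pi> ^ i * a (i + N)) = (\<Sum>i<K + N. \<pi> ^ i * a i)"
      by (rule sum_leading_zeros[symmetric]) (rule a0)
    also have "\<dots> = (\<Sum>i<K. \<pi> ^ i * a i) + (\<Sum>i<N. \<pi> ^ (i + K) * a (i + K))"
      by (induction N) (simp_all add: add_ac)
    finally show "\<pi> ^ K dvd (\<Sum>i<K. \<pi> ^ i * (\<pi> ^ N * a (i + N) - a i))"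
      by (simp add: power_add dvd_sum)
  qed
  then show "\<exists>m. (\<forall>n>m. \<pi> ^ N * f (q - of_nat n) - f (q - of_nat n - of_nat N) = 0) \<and>
      vanishing (\<lambda>i. \<pi> ^ N * f (q - of_nat m + of_nat i) - f (q - of_nat m + of_nat i - of_nat N))"
    unfolding aN unfolding a_def by (intro exI[of _ m]) (simp add: zero zero')
qed

text \<open>\<open>1 + \<pi>\<^sup>N\<close> is invertible modulo \<open>\<pi>\<^sup>K\<close>, the inverse being a truncated geometric series.\<close>

lemma power_dvd_unit_cancel:
  assumes "N > 0" "\<pi> ^ K dvd (1 + \<pi> ^ N) * s"
  shows "\<pi> ^ K dvd s"
proof -
  define x where "x = - (\<pi> ^ N)"
  have "\<pi> dvd x" unfolding x_def using assms(1) by (simp add: dvd_power)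
  then have "\<pi> ^ K dvd x ^ K" by (rule dvd_power_same)
  have "1 - x ^ K = (1 - x) * (\<Sum>i<K. x ^ i)"
    by (rule one_diff_power_eq)
  then have "(1 - x ^ K) * s = (1 - x) * (\<Sum>i<K. x ^ i) * s" by (rule arg_cong)
  also have "\<dots> = (1 - x) * s * (\<Sum>i<K. x ^ i)" by (simp only: mult.assoc mult.commute[of s])
  finally have eq: "(1 - x ^ K) * s = (1 - x) * s * (\<Sum>i<K. x ^ i)" .
  have "\<pi> ^ K dvd (1 - x) * s" using assms(2) by (simp add: x_def)
  then have "\<pi> ^ K dvd (1 - x ^ K) * s" unfolding eq by (rule dvd_mult2)
  moreover have "\<pi> ^ K dvd x ^ K * s" using \<open>\<pi> ^ K dvd x ^ K\<close> by (rule dvd_mult2)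
  ultimately have "\<pi> ^ K dvd (1 - x ^ K) * s + x ^ K * s" by (rule dvd_add)
  then show ?thesis by (simp add: left_diff_distrib)
qed

lemma null_unit_cancel:
  assumes N: "N > 0" and f: "well_ordered (supp f)" and null: "null (\<lambda>q. (1 + \<pi> ^ N) * f q)"
  shows "null f"
  unfolding null_def
proof
  fix q
  obtain m where "\<And>n. n > m \<Longrightarrow> q - of_nat n \<notin> supp f"
    using well_ordered_int_bound[OF f] by blast
  then have zero: "f (q - of_nat n) = 0" if "n > m" for n
    using that by (simp add: supp_def)
  have van: "vanishing (\<lambda>i. (1 + \<pi> ^ N) * f (q - of_nat m + of_nat i))"
    by (rule null_vanishing[OF null]) (simp add: zero)
  have eq: "(\<Sum>i<K. \<pi> ^ i * ((1 + \<pi> ^ N) * f (q - of_nat m + of_nat i))) =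
      (1 + \<pi> ^ N) * (\<Sum>i<K. \<pi> ^ i * f (q - of_nat m + of_nat i))" for K
    by (subst sum_distrib_left) (rule sum.cong[OF refl], rule mult.left_commute)
  have "\<pi> ^ K dvd (1 + \<pi> ^ N) * (\<Sum>i<K. \<pi> ^ i * f (q - of_nat m + of_nat i))" for K
    using van unfolding vanishing_def eq by (rule spec)
  then have "\<pi> ^ K dvd (\<Sum>i<K. \<pi> ^ i * f (q - of_nat m + of_nat i))" for K
    by (rule power_dvd_unit_cancel[OF N])
  then have "vanishing (\<lambda>i. f (q - of_nat m + of_nat i))"
    unfolding vanishing_def by (rule allI)
  then show "\<exists>m. (\<forall>n>m. f (q - of_nat n) = 0) \<and> vanishing (\<lambda>i. f (q - of_nat m + of_nat i))"
    using zero by blast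
qed

end

section \<open>Expansions into digits\<close>

context digit_system
begin

definition lead_digit :: "'w \<Rightarrow> 'k" where
  "lead_digit x = (SOME a. \<exists>y. x = t a + \<pi> * y)"

definition quot :: "'w \<Rightarrow> 'w" where
  "quot x = (SOME y. x = t (lead_digit x) + \<pi> * y)"

lemma digit_decomp: "x = t (lead_digit x) + \<pi> * quot x"
proof -
  have "\<exists>y. x = t (lead_digit x) + \<pi> * y"
    unfolding lead_digit_def using digit_exists by (rule someI_ex)
  then show ?thesis unfolding quot_def by (rule someI_ex)
qed

lemma lead_digit_zero [simp]: "lead_digit 0 = 0"
proof -
  have "t 0 - t (lead_digit 0) = \<pi> * quot 0"
    using digit_decomp[of 0] by (simp add: neg_eq_iff_add_eq_0)
  then have "\<pi> dvd t 0 - t (lead_digit 0)" by simp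
  then have "0 = lead_digit 0" by (rule digit_unique)
  then show ?thesis by simp
qed

lemma quot_zero [simp]: "quot 0 = 0"
proof (rule cancel)
  show "\<pi> * quot 0 = \<pi> * 0" using digit_decomp[of 0] by simp
qed

text \<open>Digits are produced as in written addition: going up a coset of \<open>\<int>\<close>, split the coefficient plus the
  incoming carry into a digit and \<open>\<pi>\<close> times the outgoing carry. Here \<open>carry_from f n q\<close> is the carry
  into position \<open>q\<close> when the process starts at \<open>q - n\<close> without a carry; below the support the starting point is
  immaterial.\<close>

primrec carry_from :: "(rat \<Rightarrow> 'w) \<Rightarrow> nat \<Rightarrow> rat \<Rightarrow> 'w" where
  "carry_from f 0 q = 0"
| "carry_from f (Suc n) q = quot (f (q - 1) + carry_from f n (q - 1))"

lemma carry_from_stable: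
  assumes "\<And>n. n > m \<Longrightarrow> f (q - of_nat n) = 0"
  shows "carry_from f (m + d) q = carry_from f m q"
  using assms
proof (induction m arbitrary: q)
  case 0
  then show ?case
  proof (induction d arbitrary: q)
    case (Suc d)
    have "f (q - 1 - of_nat n) = 0" for n
      using Suc.prems[of "Suc n"] by (simp add: algebra_simps)
    then have "f (q - 1) = 0" "carry_from f d (q - 1) = 0"
      using Suc.IH[of "q - 1"] Suc.prems[of 1] by simp_all
    then show ?case by simp
  qed simp
next
  case (Suc m)
  have "f (q - 1 - of_nat n) = 0" if "n > m" for n
    using Suc.prems[of "Suc n"] that by (simp add: algebra_simps)
  then have "carry_from f (m + d) (q - 1) = carry_from f m (q - 1)" by (rule Suc.IH)
  then show ?case by simp
qed

definition carry :: "(rat \<Rightarrow> 'w) \<Rightarrow> rat \<Rightarrow> 'w" where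
  "carry f q = carry_from f (SOME m. \<forall>n>m. f (q - of_nat n) = 0) q"

lemma carry_eq:
  assumes m: "\<And>n. n > m \<Longrightarrow> f (q - of_nat n) = 0"
  shows "carry f q = carry_from f m q"
proof -
  define m' where "m' = (SOME m. \<forall>n>m. f (q - of_nat n) = 0)"
  have "\<exists>m. \<forall>n>m. f (q - of_nat n) = 0" using m by blast
  then have "\<forall>n>m'. f (q - of_nat n) = 0" unfolding m'_def by (rule someI_ex)
  then have "carry_from f (m' + m) q = carry_from f m' q"
    by (intro carry_from_stable) simp
  moreover have "carry_from f (m + m') q = carry_from f m q"
    by (rule carry_from_stable) (rule m)
  ultimately show ?thesis by (simp add: carry_def m'_def add.commute)
qed

definition digit :: "(rat \<Rightarrow> 'w) \<Rightarrow> rat \<Rightarrow> 'k" where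
  "digit f q = lead_digit (f q + carry f q)"

lemma digit_carry:
  assumes m: "\<And>n. n > m \<Longrightarrow> f (q - of_nat n) = 0"
  shows "f q + carry f q = t (digit f q) + \<pi> * carry f (q + 1)"
proof -
  have "f (q + 1 - of_nat n) = 0" if "n > Suc m" for n
  proof -
    have eq: "q + 1 - of_nat n = q - of_nat (n - 1)" using that by (simp add: of_nat_diff)
    show ?thesis unfolding eq by (rule m) (use that in simp)
  qed
  then have "carry f (q + 1) = carry_from f (Suc m) (q + 1)" by (rule carry_eq)
  also have "\<dots> = quot (f q + carry f q)" using carry_eq[of m f q] m by simp
  finally show ?thesis using digit_decomp[of "f q + carry f q"] by (simp add: digit_def)
qed

text \<open>Carries move upwards only, by integral steps; hence the digits of a series with well-ordered
  support have well-ordered support as well.\<close>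

lemma supp_digit: "supp (digit f) \<subseteq> sumset (supp f) (range of_nat)"
proof
  fix q assume q: "q \<in> supp (digit f)"
  have "\<exists>n::nat. f (q - of_nat n) \<noteq> 0"
  proof (rule ccontr)
    assume "\<nexists>n::nat. f (q - of_nat n) \<noteq> 0"
    then have zero: "f (q - of_nat n) = 0" for n by blast
    then have "carry f q = carry_from f 0 q" by (intro carry_eq)
    then show False using q zero[of 0] by (simp add: supp_def digit_def)
  qed
  then obtain n :: nat where "q - of_nat n \<in> supp f" by (auto simp: supp_def)
  moreover have "q = (q - of_nat n) + of_nat n" by simp
  ultimately show "q \<in> sumset (supp f) (range of_nat)" unfolding sumset_def by blast
qed

lemma well_ordered_range_of_nat: "well_ordered (range of_nat)"
  unfolding well_ordered_iff
proof (intro allI impI)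
  fix T :: "rat set" assume T: "T \<subseteq> range of_nat" "T \<noteq> {}"
  define n where "n = (LEAST n. of_nat n \<in> T)"
  have "\<exists>n. of_nat n \<in> T" using T by blast
  then have "of_nat n \<in> T" unfolding n_def by (rule LeastI_ex)
  moreover have "of_nat n \<le> s" if "s \<in> T" for s
  proof -
    obtain k where "s = of_nat k" using \<open>s \<in> T\<close> T(1) by blast
    then show ?thesis using that by (simp add: n_def Least_le)
  qed
  ultimately show "\<exists>m\<in>T. \<forall>t\<in>T. m \<le> t" by blast
qed

lemma well_ordered_supp_digit: "well_ordered (supp f) \<Longrightarrow> well_ordered (supp (digit f))"
  by (rule well_ordered_subset[OF well_ordered_sumset[OF _ well_ordered_range_of_nat] supp_digit])

text \<open>The partial sums of the difference telescope to the outgoing carry times a power of \<open>\<pi>\<close>.\<close>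

lemma null_digit:
  assumes f: "well_ordered (supp f)"
  shows "null (\<lambda>q. f q - t (digit f q))"
  unfolding null_def
proof
  fix q
  obtain m where "\<And>n. n > m \<Longrightarrow> q - of_nat n \<notin> sumset (supp f) (range of_nat)"
    using well_ordered_int_bound[OF well_ordered_sumset[OF f well_ordered_range_of_nat]] by blast
  then have notin: "q - of_nat n \<notin> supp (digit f)" "q - of_nat n \<notin> supp f" if "n > m" for n
  proof -
    show "q - of_nat n \<notin> supp (digit f)"
      using supp_digit[of f] \<open>\<And>n. n > m \<Longrightarrow> q - of_nat n \<notin> sumset (supp f) (range of_nat)\<close>[OF that] by blast
    have "q - of_nat n = (q - of_nat n) + of_nat 0" by simp
    then show "q - of_nat n \<notin> supp f"
      using \<open>\<And>n. n > m \<Longrightarrow> q - of_nat n \<notin> sumset (supp f) (range of_nat)\<close>[OF that]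
      unfolding sumset_def by blast
  qed
  have zero: "f (q - of_nat n) = 0" "digit f (q - of_nat n) = 0" if "n > m" for n
    using notin[OF that] by (simp_all add: supp_def)
  define s where "s i = q - of_nat m + of_nat i" for i
  have step: "f (s i) - t (digit f (s i)) = \<pi> * carry f (s (Suc i)) - carry f (s i)" for i
  proof -
    have "f (s i - of_nat n) = 0" if "n > i" for n
    proof -
      have eq: "s i - of_nat n = q - of_nat (m + n - i)" using that by (simp add: s_def of_nat_diff)
      show ?thesis unfolding eq by (rule zero(1)) (use that in simp)
    qed
    then have "f (s i) + carry f (s i) = t (digit f (s i)) + \<pi> * carry f (s i + 1)" by (rule digit_carry)
    moreover have "s i + 1 = s (Suc i)" by (simp add: s_def)
    ultimately show ?thesis by (simp add: algebra_simps)
  qed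
  have "f (s 0 - of_nat n) = 0" if "n > 0" for n
    using zero(1)[of "m + n"] that by (simp add: s_def diff_diff_eq)
  then have "carry f (s 0) = carry_from f 0 (s 0)" by (rule carry_eq)
  then have carry0: "carry f (s 0) = 0" by simp
  have "(\<Sum>i<K. \<pi> ^ i * (f (s i) - t (digit f (s i)))) = \<pi> ^ K * carry f (s K)" for K
    by (induction K) (simp_all add: carry0 step right_diff_distrib mult.assoc power_commutes)
  then have "vanishing (\<lambda>i. f (s i) - t (digit f (s i)))"
    by (simp add: vanishing_def)
  then show "\<exists>m. (\<forall>n>m. f (q - of_nat n) - t (digit f (q - of_nat n)) = 0) \<and>
      vanishing (\<lambda>i. f (q - of_nat m + of_nat i) - t (digit f (q - of_nat m + of_nat i)))"
    unfolding s_def by (intro exI[of _ m]) (simp add: zero)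
qed

text \<open>Going up a coset, the first position where the digits differ would contribute a digit difference
  divisible by \<open>\<pi>\<close>.\<close>

lemma null_digits_unique:
  assumes r: "well_ordered (supp r)" and r': "well_ordered (supp r')"
    and null: "null (\<lambda>q. t (r q) - t (r' q))"
  shows "r = r'"
proof
  fix q
  obtain m where m: "\<And>n. n > m \<Longrightarrow> q - of_nat n \<notin> supp r \<union> supp r'"
    using well_ordered_int_bound[OF well_ordered_union[OF r r']] by blast
  have "vanishing (\<lambda>i. t (r (q - of_nat m + of_nat i)) - t (r' (q - of_nat m + of_nat i)))"
    by (rule null_vanishing[OF null]) (use m in \<open>simp add: supp_def\<close>)
  then have dvd: "\<pi> ^ K dvd (\<Sum>i<K. \<pi> ^ i * (t (r (q - of_nat m + of_nat i)) - t (r' (q - of_nat m + of_nat i))))" for K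
    unfolding vanishing_def by blast
  have "r (q - of_nat m + of_nat i) = r' (q - of_nat m + of_nat i)" for i
  proof (induction i rule: less_induct)
    case (less i)
    have "(\<Sum>j<Suc i. \<pi> ^ j * (t (r (q - of_nat m + of_nat j)) - t (r' (q - of_nat m + of_nat j)))) =
        \<pi> ^ i * (t (r (q - of_nat m + of_nat i)) - t (r' (q - of_nat m + of_nat i)))"
      using less by simp
    then have "\<pi> ^ (1 + i) dvd \<pi> ^ i * (t (r (q - of_nat m + of_nat i)) - t (r' (q - of_nat m + of_nat i)))"
      using dvd[of "Suc i"] by simp
    then have "\<pi> ^ 1 dvd t (r (q - of_nat m + of_nat i)) - t (r' (q - of_nat m + of_nat i))"
      by (rule power_dvd_cancel)
    then show ?case by (simp add: digit_unique)
  qed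
  from this[of m] show "r q = r' q" by simp
qed

end

section \<open>The ring of Hahn series over the Witt vectors\<close>

text \<open>The record-based rings of the definitions are translated into the ring type class, where the
  preceding results live; \<open>Witt\<close> and \<open>witt_coords\<close> mediate between the two.\<close>

lemma W_Fp_bar_simps:
  "carrier (W_Fp_bar :: (nat \<Rightarrow> 'p::prime_card Fp_bar) ring) = UNIV"
  "x \<otimes>\<^bsub>W_Fp_bar\<^esub> y = witt_coords (Witt x * Witt y)"
  "x \<oplus>\<^bsub>W_Fp_bar\<^esub> y = witt_coords (Witt x + Witt y)"
  "\<one>\<^bsub>W_Fp_bar\<^esub> = witt_coords (1 :: 'p witt)"
  "\<zero>\<^bsub>W_Fp_bar\<^esub> = witt_coords (0 :: 'p witt)"
  by (simp_all add: W_Fp_bar_def witt_ring_def times_witt_def plus_witt_def one_witt_def zero_witt_def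
      witt_mult_def[abs_def] witt_add_def[abs_def])

lemma W_Fp_bar_cring: "cring (W_Fp_bar :: (nat \<Rightarrow> 'p::prime_card Fp_bar) ring)"
proof (rule cringI)
  let ?W = "W_Fp_bar :: (nat \<Rightarrow> 'p Fp_bar) ring"
  show "abelian_group ?W"
  proof (rule abelian_groupI)
    fix x
    have "witt_coords (- Witt x) \<oplus>\<^bsub>?W\<^esub> x = \<zero>\<^bsub>?W\<^esub>" by (simp add: W_Fp_bar_simps)
    then show "\<exists>y\<in>carrier ?W. y \<oplus>\<^bsub>?W\<^esub> x = \<zero>\<^bsub>?W\<^esub>" by (auto simp: W_Fp_bar_simps(1))
  qed (simp_all add: W_Fp_bar_simps add_ac)
  show "comm_monoid ?W"
    by (rule comm_monoidI) (simp_all add: W_Fp_bar_simps mult_ac)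
qed (simp_all add: W_Fp_bar_simps distrib_right)

lemma W_Fp_bar_minus:
  fixes x y :: "nat \<Rightarrow> 'p::prime_card Fp_bar"
  shows "x \<ominus>\<^bsub>W_Fp_bar\<^esub> y = witt_coords (Witt x - Witt y)"
proof -
  interpret cring "W_Fp_bar :: (nat \<Rightarrow> 'p Fp_bar) ring" by (rule W_Fp_bar_cring)
  have "\<ominus>\<^bsub>W_Fp_bar\<^esub> y = witt_coords (- Witt y)"
    by (rule minus_equality) (simp_all add: W_Fp_bar_simps)
  then show ?thesis by (simp add: a_minus_def W_Fp_bar_simps)
qed

lemma W_Fp_bar_finsum:
  fixes f :: "'i \<Rightarrow> nat \<Rightarrow> 'p::prime_card Fp_bar"
  shows "(\<Oplus>\<^bsub>W_Fp_bar\<^esub>a\<in>A. f a) = witt_coords (\<Sum>a\<in>A. Witt (f a))"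
proof -
  interpret cring "W_Fp_bar :: (nat \<Rightarrow> 'p Fp_bar) ring" by (rule W_Fp_bar_cring)
  show ?thesis
    by (induction A rule: infinite_finite_induct) (simp_all add: W_Fp_bar_simps finsum_infinite)
qed

lemma W_Fp_bar_add_pow:
  fixes x :: "nat \<Rightarrow> 'p::prime_card Fp_bar"
  shows "[(n::nat)] \<cdot>\<^bsub>W_Fp_bar\<^esub> x = witt_coords (of_nat n * Witt x)"
proof -
  interpret cring "W_Fp_bar :: (nat \<Rightarrow> 'p Fp_bar) ring" by (rule W_Fp_bar_cring)
  show ?thesis
    by (induction n) (simp_all add: W_Fp_bar_simps add.nat_pow_Suc distrib_right add.commute)
qed

lemma witt_digit_system: "digit_system (witt_teich :: 'p::prime_card Fp_bar \<Rightarrow> 'p witt) (of_nat CARD('p))"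
proof
  show "\<exists>a y. x = witt_teich a + of_nat CARD('p) * y" for x :: "'p witt"
    using witt_teich_expansion by blast
qed (auto intro: CARD_mult_witt_cancel witt_teich_cong)

interpretation witt: digit_system "witt_teich :: 'p::prime_card Fp_bar \<Rightarrow> 'p witt" "of_nat CARD('p)"
  by (rule witt_digit_system)

lemma padic_sums_zero_iff:
  fixes a :: "nat \<Rightarrow> nat \<Rightarrow> 'p::prime_card Fp_bar"
  shows "padic_sums W_Fp_bar CARD('p) a \<zero>\<^bsub>W_Fp_bar\<^esub> \<longleftrightarrow> witt.vanishing (\<lambda>i. Witt (a i))"
proof -
  have "witt_coords x \<in> (\<lambda>c. witt_coords (y * Witt c)) ` UNIV \<longleftrightarrow> y dvd x" for x y :: "'p witt"
  proof -
    have "witt_coords x \<in> (\<lambda>c. witt_coords (y * Witt c)) ` UNIV \<longleftrightarrow> (\<exists>c. x = y * Witt c)"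
      by (auto simp: witt_coords_inject)
    also have "\<dots> \<longleftrightarrow> y dvd x" unfolding dvd_def by (metis witt_inverse(2))
    finally show ?thesis .
  qed
  then show ?thesis
    by (simp add: padic_sums_def W_Fp_bar_simps W_Fp_bar_finsum W_Fp_bar_add_pow W_Fp_bar_minus
        witt.vanishing_iff_tends_to_zero)
qed

definition witt_series :: "(rat \<Rightarrow> nat \<Rightarrow> 'p::prime_card Fp_bar) \<Rightarrow> rat \<Rightarrow> 'p witt" where
  "witt_series f q = Witt (f q)"

lemma hahn_support_W: "hahn_support W_Fp_bar f = supp (witt_series f)"
  by (auto simp: hahn_support_def supp_def witt_series_def W_Fp_bar_simps) (metis witt_inverse)+

abbreviation W_hahn :: "(rat \<Rightarrow> nat \<Rightarrow> 'p::prime_card Fp_bar) ring" where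
  "W_hahn \<equiv> hahn_ring W_Fp_bar"

lemma W_hahn_simps:
  "f \<in> carrier W_hahn \<longleftrightarrow> well_ordered (supp (witt_series f))"
  "witt_series (f \<otimes>\<^bsub>W_hahn\<^esub> g) = conv (witt_series f) (witt_series g)"
  "witt_series (f \<oplus>\<^bsub>W_hahn\<^esub> g) = (\<lambda>q. witt_series f q + witt_series g q)"
  "witt_series \<one>\<^bsub>W_hahn\<^esub> = single_term 1 0"
  "witt_series \<zero>\<^bsub>W_hahn\<^esub> = (\<lambda>q. 0)"
proof -
  show "f \<in> carrier W_hahn \<longleftrightarrow> well_ordered (supp (witt_series f))"
    by (simp add: hahn_ring_def hahn_support_W W_Fp_bar_simps)
  show "witt_series (f \<otimes>\<^bsub>W_hahn\<^esub> g) = conv (witt_series f) (witt_series g)"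
    by (simp add: fun_eq_iff hahn_ring_def hahn_support_W conv_def W_Fp_bar_finsum W_Fp_bar_simps)
      (simp add: witt_series_def supp_def W_Fp_bar_finsum W_Fp_bar_simps)
qed (simp_all add: fun_eq_iff hahn_ring_def witt_series_def W_Fp_bar_simps hahn_monom_def single_term_def)

lemma witt_series_inject: "witt_series f = witt_series g \<longleftrightarrow> f = g"
  by (auto simp: fun_eq_iff witt_series_def)

lemma witt_series_surj: "witt_series (\<lambda>q. witt_coords (F q)) = F"
  by (simp add: fun_eq_iff witt_series_def)

lemma W_hahn_cring: "cring (W_hahn :: (rat \<Rightarrow> nat \<Rightarrow> 'p::prime_card Fp_bar) ring)"
proof (rule cringI)
  let ?H = "W_hahn :: (rat \<Rightarrow> nat \<Rightarrow> 'p Fp_bar) ring"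
  note eqI = witt_series_inject[THEN iffD1]
  have zero: "supp (\<lambda>q. 0 :: 'p witt) = {}" by (simp add: supp_def)
  show "abelian_group ?H"
  proof (rule abelian_groupI)
    fix x y z assume xyz: "x \<in> carrier ?H" "y \<in> carrier ?H" "z \<in> carrier ?H"
    show "x \<oplus>\<^bsub>?H\<^esub> y \<in> carrier ?H"
      using xyz by (simp add: W_hahn_simps well_ordered_supp_add)
    show "x \<oplus>\<^bsub>?H\<^esub> y \<oplus>\<^bsub>?H\<^esub> z = x \<oplus>\<^bsub>?H\<^esub> (y \<oplus>\<^bsub>?H\<^esub> z)"
      by (rule eqI) (simp add: W_hahn_simps add_ac)
    show "x \<oplus>\<^bsub>?H\<^esub> y = y \<oplus>\<^bsub>?H\<^esub> x"
      by (rule eqI) (simp add: W_hahn_simps add_ac)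
    show "\<zero>\<^bsub>?H\<^esub> \<oplus>\<^bsub>?H\<^esub> x = x"
      by (rule eqI) (simp add: W_hahn_simps)
  next
    fix x assume x: "x \<in> carrier ?H"
    let ?y = "\<lambda>q. witt_coords (- witt_series x q)"
    have "?y \<in> carrier ?H" using x by (simp add: W_hahn_simps witt_series_surj)
    moreover have "?y \<oplus>\<^bsub>?H\<^esub> x = \<zero>\<^bsub>?H\<^esub>"
      by (rule eqI) (simp add: W_hahn_simps witt_series_surj)
    ultimately show "\<exists>y\<in>carrier ?H. y \<oplus>\<^bsub>?H\<^esub> x = \<zero>\<^bsub>?H\<^esub>" by blast
  qed (simp add: W_hahn_simps zero)
  show "comm_monoid ?H"
  proof (rule comm_monoidI)
    fix x y z assume xyz: "x \<in> carrier ?H" "y \<in> carrier ?H" "z \<in> carrier ?H"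
    show "x \<otimes>\<^bsub>?H\<^esub> y \<in> carrier ?H"
      using xyz by (simp add: W_hahn_simps well_ordered_supp_conv)
    show "x \<otimes>\<^bsub>?H\<^esub> y \<otimes>\<^bsub>?H\<^esub> z = x \<otimes>\<^bsub>?H\<^esub> (y \<otimes>\<^bsub>?H\<^esub> z)"
      by (rule eqI) (use xyz in \<open>simp add: W_hahn_simps conv_assoc\<close>)
    show "x \<otimes>\<^bsub>?H\<^esub> y = y \<otimes>\<^bsub>?H\<^esub> x"
      by (rule eqI) (simp only: W_hahn_simps, rule conv_commute)
    show "\<one>\<^bsub>?H\<^esub> \<otimes>\<^bsub>?H\<^esub> x = x"
      by (rule eqI) (simp add: W_hahn_simps conv_single_term)
  qed (simp add: W_hahn_simps)
  show "(x \<oplus>\<^bsub>?H\<^esub> y) \<otimes>\<^bsub>?H\<^esub> z = x \<otimes>\<^bsub>?H\<^esub> z \<oplus>\<^bsub>?H\<^esub> y \<otimes>\<^bsub>?H\<^esub> z"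
    if "x \<in> carrier ?H" "y \<in> carrier ?H" "z \<in> carrier ?H" for x y z
    by (rule eqI) (use that in \<open>simp add: W_hahn_simps conv_add_left\<close>)
qed

lemma witt_series_uminus:
  fixes f :: "rat \<Rightarrow> nat \<Rightarrow> 'p::prime_card Fp_bar"
  assumes "f \<in> carrier W_hahn"
  shows "witt_series (\<ominus>\<^bsub>W_hahn\<^esub> f) = (\<lambda>q. - witt_series f q)"
proof -
  interpret cring "W_hahn :: (rat \<Rightarrow> nat \<Rightarrow> 'p Fp_bar) ring" by (rule W_hahn_cring)
  let ?g = "\<lambda>q. witt_coords (- witt_series f q)"
  have "?g \<in> carrier W_hahn" using assms by (simp add: W_hahn_simps witt_series_surj)
  moreover have "?g \<oplus>\<^bsub>W_hahn\<^esub> f = \<zero>\<^bsub>W_hahn\<^esub>"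
    by (rule witt_series_inject[THEN iffD1]) (simp add: W_hahn_simps witt_series_surj)
  ultimately have "\<ominus>\<^bsub>W_hahn\<^esub> f = ?g" using assms by (intro minus_equality)
  then show ?thesis by (simp add: witt_series_surj)
qed

lemma hahn_null_iff:
  fixes f :: "rat \<Rightarrow> nat \<Rightarrow> 'p::prime_card Fp_bar"
  shows "f \<in> hahn_null W_Fp_bar CARD('p) \<longleftrightarrow> f \<in> carrier W_hahn \<and> witt.null (witt_series f)"
proof -
  have "(\<forall>n::int. n < - int m \<longrightarrow> f (q + of_int n) = \<zero>\<^bsub>W_Fp_bar\<^esub>) \<longleftrightarrow>
      (\<forall>n>m. witt_series f (q - of_nat n) = 0)" for m q
  proof -
    have zero: "f s = \<zero>\<^bsub>W_Fp_bar\<^esub> \<longleftrightarrow> witt_series f s = 0" for s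
      unfolding W_Fp_bar_simps witt_series_def by (metis witt_inverse)
    show ?thesis
      unfolding zero
    proof (intro iffI allI impI)
      fix n assume h: "\<forall>n::int. n < - int m \<longrightarrow> witt_series f (q + of_int n) = 0" "n > m"
      have "witt_series f (q + of_int (- int n)) = 0"
        by (rule h(1)[rule_format]) (use h(2) in simp)
      then show "witt_series f (q - of_nat n) = 0" by simp
    next
      fix n :: int assume h: "\<forall>n>m. witt_series f (q - of_nat n) = 0" "n < - int m"
      have "witt_series f (q - of_nat (nat (- n))) = 0"
        by (rule h(1)[rule_format]) (use h(2) in simp)
      moreover have "q - of_nat (nat (- n)) = q + of_int n" using h(2) by simp
      ultimately show "witt_series f (q + of_int n) = 0" by (simp only:)
    qed
  qed
  then show ?thesis
    by (simp add: hahn_null_def witt.null_def padic_sums_zero_iff witt_series_def)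
qed

lemma hahn_null_ideal: "ideal (hahn_null W_Fp_bar CARD('p)) (W_hahn :: (rat \<Rightarrow> nat \<Rightarrow> 'p::prime_card Fp_bar) ring)"
proof (rule idealI)
  let ?H = "W_hahn :: (rat \<Rightarrow> nat \<Rightarrow> 'p Fp_bar) ring" and ?N = "hahn_null (W_Fp_bar :: (nat \<Rightarrow> 'p Fp_bar) ring) CARD('p)"
  interpret cring ?H by (rule W_hahn_cring)
  show "ring ?H" by (rule ring_axioms)
  show "subgroup ?N (add_monoid ?H)"
  proof (rule add.subgroupI)
    show "?N \<subseteq> carrier ?H" by (auto simp: hahn_null_iff)
    have "\<zero>\<^bsub>?H\<^esub> \<in> ?N" by (simp add: hahn_null_iff W_hahn_simps(5) witt.null_zero)
    then show "?N \<noteq> {}" by blast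
    show "\<ominus>\<^bsub>?H\<^esub> f \<in> ?N" if "f \<in> ?N" for f
      using that by (simp add: hahn_null_iff witt_series_uminus witt.null_uminus)
    show "f \<oplus>\<^bsub>?H\<^esub> g \<in> ?N" if "f \<in> ?N" "g \<in> ?N" for f g
      using that by (simp add: hahn_null_iff W_hahn_simps(3) witt.null_add)
  qed
  show "f \<otimes>\<^bsub>?H\<^esub> g \<in> ?N" if "g \<in> ?N" "f \<in> carrier ?H" for f g
    using that by (simp add: hahn_null_iff W_hahn_simps(2)) (simp add: W_hahn_simps(1) witt.null_conv)
  then show "g \<otimes>\<^bsub>?H\<^esub> f \<in> ?N" if "g \<in> ?N" "f \<in> carrier ?H" for f g
    using that by (metis hahn_null_iff m_comm)
qed

section \<open>Algebraicity of multiples\<close>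

context cring
begin

text \<open>If \<open>x\<close> is a root of \<open>\<Sum>i. a\<^sub>i X\<^sup>i\<close>, then \<open>c x\<close> is a root of \<open>\<Sum>i. c\<^sup>n\<^sup>-\<^sup>i a\<^sub>i X\<^sup>i\<close>. Coefficients are listed by
  decreasing degree, so that the degree belonging to the head of a list is the length of its tail.\<close>

primrec scale_coeffs :: "'a \<Rightarrow> nat \<Rightarrow> 'a list \<Rightarrow> 'a list" where
  "scale_coeffs c n [] = []"
| "scale_coeffs c n (a # as) = (c [^] (n - length as) \<otimes> a) # scale_coeffs c n as"

lemma length_scale_coeffs [simp]: "length (scale_coeffs c n as) = length as"
  by (induction as) simp_all

lemma scale_coeffs_eq_Nil_iff [simp]: "scale_coeffs c n as = [] \<longleftrightarrow> as = []"
  by (cases as) simp_all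

lemma eval_scale_coeffs:
  assumes "c \<in> carrier R" "x \<in> carrier R" "set as \<subseteq> carrier R" "length as \<le> Suc n"
  shows "eval (scale_coeffs c n as) (c \<otimes> x) = c [^] n \<otimes> eval as x"
  using assms(3,4)
proof (induction as)
  case Nil
  then show ?case using assms(1) by simp
next
  case (Cons a as)
  have closed: "a \<in> carrier R" "eval as x \<in> carrier R"
    using Cons.prems assms(2) by (simp_all add: eval_in_carrier)
  let ?l = "length as"
  have pow: "c [^] n = c [^] (n - ?l) \<otimes> c [^] ?l"
    using Cons.prems assms(1) by (simp add: nat_pow_mult)
  have "eval (scale_coeffs c n (a # as)) (c \<otimes> x) =
      (c [^] (n - ?l) \<otimes> a) \<otimes> (c \<otimes> x) [^] ?l \<oplus> eval (scale_coeffs c n as) (c \<otimes> x)"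
    by simp
  also have "(c [^] (n - ?l) \<otimes> a) \<otimes> (c \<otimes> x) [^] ?l = c [^] n \<otimes> (a \<otimes> x [^] ?l)"
    unfolding pow using closed assms(1,2) by (simp add: nat_pow_distrib m_ac)
  also have "eval (scale_coeffs c n as) (c \<otimes> x) = c [^] n \<otimes> eval as x"
    using Cons by simp
  also have "c [^] n \<otimes> (a \<otimes> x [^] ?l) \<oplus> c [^] n \<otimes> eval as x = c [^] n \<otimes> eval (a # as) x"
    using closed assms(1,2) by (simp add: r_distr)
  finally show ?case .
qed

text \<open>Algebraicity means that two distinct polynomials over \<open>K\<close> take the same value at \<open>x\<close>. Scaling both with the same
  exponent \<open>n\<close> multiplies the two values by \<open>c\<^sup>n\<close> and keeps the polynomials distinct, since \<open>c\<close> is not a zero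
  divisor. Working with regular elements avoids inverting \<open>c\<close>, so \<open>K\<close> may be any subset closed
  under multiplication by \<open>c\<close>.\<close>

lemma algebraic_mult_regular:
  assumes K: "K \<subseteq> carrier R" and c: "c \<in> carrier R" and x: "x \<in> carrier R"
    and cK: "\<And>a. a \<in> K \<Longrightarrow> c \<otimes> a \<in> K"
    and regular: "\<And>z. z \<in> carrier R \<Longrightarrow> c \<otimes> z = \<zero> \<Longrightarrow> z = \<zero>"
    and alg: "(algebraic over K) x"
  shows "(algebraic over K) (c \<otimes> x)"
proof -
  have powK: "c [^] (k::nat) \<otimes> a \<in> K" if "a \<in> K" for k a
    using that
  proof (induction k)
    case (Suc k)
    have "a \<in> carrier R" using Suc.prems K by blast
    then have "c [^] Suc k \<otimes> a = c \<otimes> (c [^] k \<otimes> a)"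
      using c by (simp only: nat_pow_Suc2 m_assoc nat_pow_closed)
    then show ?case using Suc cK by simp
  qed (use K in auto)
  have pow_regular: "z = \<zero>" if "z \<in> carrier R" "c [^] (k::nat) \<otimes> z = \<zero>" for k z
    using that
  proof (induction k)
    case (Suc k)
    have "c \<otimes> (c [^] k \<otimes> z) = c [^] Suc k \<otimes> z"
      using Suc.prems(1) c by (simp only: nat_pow_Suc2 m_assoc nat_pow_closed)
    with Suc.prems(2) have "c \<otimes> (c [^] k \<otimes> z) = \<zero>" by (simp only:)
    then have "c [^] k \<otimes> z = \<zero>"
      by (rule regular[rotated]) (use Suc.prems(1) c in simp)
    with Suc.prems(1) show ?case by (rule Suc.IH)
  qed simp
  have pow_cancel: "a = b"
    if "a \<in> carrier R" "b \<in> carrier R" "c [^] (k::nat) \<otimes> a = c [^] k \<otimes> b" for k a b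
  proof -
    have "c [^] k \<otimes> (a \<ominus> b) = c [^] k \<otimes> a \<ominus> c [^] k \<otimes> b"
      using that c by (simp add: a_minus_def r_distr r_minus)
    also have "\<dots> = \<zero>" unfolding that(3) using that(2) c by (simp add: r_neg a_minus_def)
    finally have "c [^] k \<otimes> (a \<ominus> b) = \<zero>" .
    then have "a \<ominus> b = \<zero>" by (rule pow_regular[rotated]) (use that in simp)
    then show ?thesis using that by simp
  qed
  have scale_in: "scale_coeffs c n as \<in> carrier (K[X])" if as: "as \<in> carrier (K[X])" for n as
  proof -
    have "set (scale_coeffs c n as) \<subseteq> K" if "set as \<subseteq> K" for as
      using that by (induction as) (auto intro: powK)
    moreover have "hd (scale_coeffs c n as) \<noteq> \<zero>" if "as \<noteq> []"
      using that as K unfolding univ_poly_def polynomial_def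
      by (cases as) (auto dest: pow_regular)
    ultimately show ?thesis using as unfolding univ_poly_def polynomial_def by auto
  qed
  have scale_inj: "as = bs"
    if "set as \<subseteq> carrier R" "set bs \<subseteq> carrier R" "scale_coeffs c n as = scale_coeffs c n bs" for n as bs
  proof -
    have "length as = length bs" using that(3) by (metis length_scale_coeffs)
    then show ?thesis using that
      by (induction as bs rule: list_induct2) (auto dest: pow_cancel)
  qed
  obtain as bs where ab: "as \<in> carrier (K[X])" "bs \<in> carrier (K[X])" "as \<noteq> bs" "eval as x = eval bs x"
    using alg unfolding over_def transcendental_def inj_on_def by blast
  define n where "n = max (length as) (length bs)"
  have sub: "set as \<subseteq> carrier R" "set bs \<subseteq> carrier R"
    using ab(1,2) K unfolding univ_poly_def polynomial_def by auto
  have "eval (scale_coeffs c n as) (c \<otimes> x) = eval (scale_coeffs c n bs) (c \<otimes> x)"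
    using ab(4) sub c x by (simp add: eval_scale_coeffs n_def)
  moreover have "scale_coeffs c n as \<noteq> scale_coeffs c n bs"
    using scale_inj[OF sub] ab(3) by blast
  ultimately show ?thesis
    using scale_in[OF ab(1)] scale_in[OF ab(2)] unfolding over_def transcendental_def inj_on_def by blast
qed

end

section \<open>Multiplication by \<open>1 + p\<^sup>N\<close> in the field of \<open>p\<close>-adic Hahn series\<close>

lemma padic_hahn_field_cring: "cring (padic_hahn_field :: 'p::prime_card padic_hahn ring)"
  unfolding padic_hahn_field_def by (rule ideal.quotient_is_cring[OF hahn_null_ideal W_hahn_cring])

definition padic_class :: "(rat \<Rightarrow> 'p::prime_card witt) \<Rightarrow> 'p padic_hahn" where
  "padic_class F = padic_hahn_of (\<lambda>q. witt_coords (F q))"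

lemma padic_hahn_of_ring_hom:
  "padic_hahn_of \<in> Ring.ring_hom (W_hahn :: (rat \<Rightarrow> nat \<Rightarrow> 'p::prime_card Fp_bar) ring) padic_hahn_field"
  unfolding padic_hahn_field_def padic_hahn_of_def[abs_def]
  by (rule ideal.rcos_ring_hom[OF hahn_null_ideal])

lemma coords_in_W_hahn [simp]:
  "(\<lambda>q. witt_coords (F q)) \<in> carrier W_hahn \<longleftrightarrow> well_ordered (supp F)"
  by (simp add: W_hahn_simps witt_series_surj)

lemma padic_class_closed:
  "well_ordered (supp F) \<Longrightarrow> padic_class F \<in> carrier (padic_hahn_field :: 'p::prime_card padic_hahn ring)"
  unfolding padic_class_def by (rule ring_hom_closed[OF padic_hahn_of_ring_hom]) simp

lemma padic_class_mult:
  assumes "well_ordered (supp F)" "well_ordered (supp G)"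
  shows "padic_class F \<otimes>\<^bsub>padic_hahn_field\<^esub> padic_class G = padic_class (conv F G)"
proof -
  let ?f = "\<lambda>q. witt_coords (F q)" and ?g = "\<lambda>q. witt_coords (G q)"
  have "padic_class F \<otimes>\<^bsub>padic_hahn_field\<^esub> padic_class G = padic_hahn_of (?f \<otimes>\<^bsub>W_hahn\<^esub> ?g)"
    unfolding padic_class_def using assms
    by (intro ring_hom_mult[OF padic_hahn_of_ring_hom, symmetric]) simp_all
  also have "?f \<otimes>\<^bsub>W_hahn\<^esub> ?g = (\<lambda>q. witt_coords (conv F G q))"
    by (rule witt_series_inject[THEN iffD1]) (simp add: W_hahn_simps witt_series_surj)
  finally show ?thesis by (simp only: padic_class_def)
qed

lemma padic_class_zero: "padic_class (\<lambda>q. 0) = \<zero>\<^bsub>padic_hahn_field :: 'p::prime_card padic_hahn ring\<^esub>"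
proof -
  have "(\<lambda>q. witt_coords 0) = \<zero>\<^bsub>W_hahn :: (rat \<Rightarrow> nat \<Rightarrow> 'p Fp_bar) ring\<^esub>"
    by (rule witt_series_inject[THEN iffD1]) (simp add: W_hahn_simps witt_series_surj)
  then show ?thesis
    unfolding padic_class_def
    using ring_hom_zero[OF padic_hahn_of_ring_hom cring.axioms(1)[OF W_hahn_cring]
        cring.axioms(1)[OF padic_hahn_field_cring]]
    by simp
qed

lemma padic_class_surj:
  fixes x :: "'p::prime_card padic_hahn"
  assumes "x \<in> carrier padic_hahn_field"
  obtains F where "well_ordered (supp F)" "x = padic_class F"
proof -
  obtain f where f: "f \<in> carrier W_hahn" "x = padic_hahn_of f"
    using assms unfolding padic_hahn_field_def padic_hahn_of_def FactRing_def A_RCOSETS_def' by auto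
  show ?thesis
  proof (rule that)
    show "well_ordered (supp (witt_series f))" using f(1) by (simp add: W_hahn_simps)
    show "x = padic_class (witt_series f)" using f(2) by (simp add: padic_class_def witt_series_def)
  qed
qed

lemma padic_class_eq_iff:
  fixes F G :: "rat \<Rightarrow> 'p::prime_card witt"
  assumes "well_ordered (supp F)" "well_ordered (supp G)"
  shows "padic_class F = padic_class G \<longleftrightarrow> witt.null (\<lambda>q. F q - G q)"
proof -
  let ?H = "W_hahn :: (rat \<Rightarrow> nat \<Rightarrow> 'p Fp_bar) ring"
  interpret cring ?H by (rule W_hahn_cring)
  let ?f = "\<lambda>q. witt_coords (F q)" and ?g = "\<lambda>q. witt_coords (G q)"
  have fg: "?f \<in> carrier ?H" "?g \<in> carrier ?H" using assms by simp_all
  have "padic_class F = padic_class G \<longleftrightarrow> ?f \<ominus>\<^bsub>?H\<^esub> ?g \<in> hahn_null W_Fp_bar CARD('p)"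
    unfolding padic_class_def padic_hahn_of_def
    by (rule quotient_eq_iff_same_a_r_cos[OF hahn_null_ideal fg, symmetric])
  also have "\<dots> \<longleftrightarrow> witt.null (witt_series (?f \<ominus>\<^bsub>?H\<^esub> ?g))"
    using fg by (simp only: hahn_null_iff minus_closed simp_thms)
  also have "witt_series (?f \<ominus>\<^bsub>?H\<^esub> ?g) = (\<lambda>q. F q - G q)"
    using fg(2) unfolding a_minus_def by (simp only: W_hahn_simps(3) witt_series_uminus witt_series_surj) simp
  finally show ?thesis .
qed

lemma witt_teich_eq_0_iff [simp]: "witt_teich a = 0 \<longleftrightarrow> a = 0"
  by (metis witt_coord_0_teich witt_teich_0)

lemma supp_witt_teich [simp]: "supp (\<lambda>q. witt_teich (r q)) = supp r"
  by (simp add: supp_def)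

lemma padic_hahn_of_teichmueller:
  "padic_hahn_of (\<lambda>q. teichmueller (r q)) = padic_class (\<lambda>q. witt_teich (r q))"
  by (simp add: padic_class_def witt_teich_def)

text \<open>Uniqueness of digits makes the definite description in \<open>standard_expansion\<close> meaningful.\<close>

lemma standard_expansion_eq:
  assumes r: "well_ordered (supp r)"
  shows "standard_expansion (padic_class (\<lambda>q. witt_teich (r q))) = r"
  unfolding standard_expansion_def padic_hahn_of_teichmueller
proof (rule the_equality)
  show "well_ordered {q. r q \<noteq> 0} \<and> padic_class (\<lambda>q. witt_teich (r q)) = padic_class (\<lambda>q. witt_teich (r q))"
    using r by (simp add: supp_def)
next
  fix r' assume r': "well_ordered {q. r' q \<noteq> 0} \<and>
      padic_class (\<lambda>q. witt_teich (r q)) = padic_class (\<lambda>q. witt_teich (r' q))"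
  then have wo: "well_ordered (supp r')" by (simp add: supp_def)
  with r r' have "witt.null (\<lambda>q. witt_teich (r q) - witt_teich (r' q))"
    by (simp add: padic_class_eq_iff)
  then show "r' = r" using witt.null_digits_unique[OF r wo] by simp
qed

lemma Supp_eq:
  assumes "well_ordered (supp r)"
  shows "Supp (padic_class (\<lambda>q. witt_teich (r q))) = supp r"
  by (simp add: Supp_def standard_expansion_eq[OF assms]) (simp add: supp_def)

lemma standard_expansion_exists:
  assumes "x \<in> carrier padic_hahn_field"
  obtains r where "well_ordered (supp r)" "x = padic_class (\<lambda>q. witt_teich (r q))"
proof -
  obtain F where F: "well_ordered (supp F)" "x = padic_class F"
    using assms by (rule padic_class_surj)
  show ?thesis
  proof (rule that)
    show wo: "well_ordered (supp (witt.digit F))" by (rule witt.well_ordered_supp_digit[OF F(1)])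
    show "x = padic_class (\<lambda>q. witt_teich (witt.digit F q))"
      unfolding F(2) using F(1) wo by (subst padic_class_eq_iff) (simp_all add: witt.null_digit)
  qed
qed

definition one_plus_p_power :: "nat \<Rightarrow> 'p::prime_card padic_hahn" where
  "one_plus_p_power N = padic_class (single_term (1 + of_nat CARD('p) ^ N) 0)"

lemma one_plus_p_power_mult:
  fixes F :: "rat \<Rightarrow> 'p::prime_card witt"
  assumes "well_ordered (supp F)"
  shows "one_plus_p_power N \<otimes>\<^bsub>padic_hahn_field\<^esub> padic_class F =
    padic_class (\<lambda>q. (1 + of_nat CARD('p) ^ N) * F q)"
  unfolding one_plus_p_power_def using assms by (simp add: padic_class_mult conv_single_term)

lemma well_ordered_supp_scale:
  fixes F :: "rat \<Rightarrow> 'w::comm_ring_1"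
  assumes "well_ordered (supp F)"
  shows "well_ordered (supp (\<lambda>q. w * F q))"
  by (rule well_ordered_subset[OF assms]) (auto simp: supp_def)

lemma one_plus_p_power_regular:
  fixes z :: "'p::prime_card padic_hahn"
  assumes "N > 0" "z \<in> carrier padic_hahn_field"
    and zero: "one_plus_p_power N \<otimes>\<^bsub>padic_hahn_field\<^esub> z = \<zero>\<^bsub>padic_hahn_field\<^esub>"
  shows "z = \<zero>\<^bsub>padic_hahn_field\<^esub>"
proof -
  obtain F where F: "well_ordered (supp F)" "z = padic_class F"
    using assms(2) by (rule padic_class_surj)
  have wo0: "well_ordered (supp (\<lambda>q. 0 :: 'p witt))" by (simp add: supp_def)
  have "padic_class (\<lambda>q. (1 + of_nat CARD('p) ^ N) * F q) = padic_class (\<lambda>q. 0)"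
    using zero F by (simp add: one_plus_p_power_mult padic_class_zero)
  then have "witt.null (\<lambda>q. (1 + of_nat CARD('p) ^ N) * F q - 0)"
    by (rule padic_class_eq_iff[OF well_ordered_supp_scale[OF F(1)] wo0, THEN iffD1])
  then have "witt.null F"
    using witt.null_unit_cancel[OF assms(1) F(1)] by simp
  then have "padic_class F = padic_class (\<lambda>q. 0)"
    by (subst padic_class_eq_iff[OF F(1) wo0]) simp
  then show ?thesis by (simp add: F(2) padic_class_zero)
qed

text \<open>Witt vectors with components in \<open>\<bbbF>\<^sub>p\<close> are closed under addition by functoriality, applied to the
  inclusion of \<open>\<bbbF>\<^sub>p\<close> into its algebraic closure.\<close>

lemma Zp_multiple:
  fixes a :: "nat \<Rightarrow> 'p::prime_card Fp_bar"
  assumes "a \<in> Zp"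
  shows "witt_coords (of_nat m * Witt a) \<in> Zp"
proof -
  interpret to_ac: comm_ring_hom "to_ac :: 'p mod_ring \<Rightarrow> 'p Fp_bar"
    by unfold_locales simp_all
  obtain b :: "nat \<Rightarrow> 'p mod_ring" where b: "a = to_ac \<circ> b" using assms unfolding Zp_def by blast
  have "witt_coords (of_nat m * Witt a) = to_ac \<circ> (witt_add CARD('p) b ^^ m) (\<lambda>_. 0)"
    by (simp only: of_nat_mult_witt witt_inverse b to_ac.hom_witt_multiple)
  then show ?thesis unfolding Zp_def by blast
qed

lemma Qp_iff:
  "x \<in> (Qp :: 'p::prime_card padic_hahn set) \<longleftrightarrow>
    (\<exists>a n. a \<in> Zp \<and> x = padic_class (single_term (Witt a) (- of_nat n)))"
proof -
  have "hahn_monom W_Fp_bar a q = (\<lambda>s. witt_coords (single_term (Witt a) q s))"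
    for a :: "nat \<Rightarrow> 'p Fp_bar" and q
    by (simp add: fun_eq_iff hahn_monom_def single_term_def W_Fp_bar_simps)
  then show ?thesis unfolding Qp_def padic_class_def by auto
qed

lemma one_plus_p_power_mult_Qp:
  fixes x :: "'p::prime_card padic_hahn"
  assumes "x \<in> Qp"
  shows "one_plus_p_power N \<otimes>\<^bsub>padic_hahn_field\<^esub> x \<in> Qp"
proof -
  obtain a n where a: "a \<in> Zp" and x: "x = padic_class (single_term (Witt a) (- of_nat n))"
    using assms unfolding Qp_iff by blast
  let ?b = "witt_coords (of_nat (1 + CARD('p) ^ N) * Witt a)"
  have "one_plus_p_power N \<otimes>\<^bsub>padic_hahn_field\<^esub> x = padic_class (single_term (Witt ?b) (- of_nat n))"
  proof -
    have "(\<lambda>q. (1 + of_nat CARD('p) ^ N) * single_term (Witt a) (- of_nat n) q) =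
        single_term (Witt ?b) (- of_nat n)"
      by (simp add: single_term_def fun_eq_iff)
    then show ?thesis
      unfolding x one_plus_p_power_mult[OF well_ordered_supp_single_term] by (rule arg_cong)
  qed
  moreover have "?b \<in> Zp" using a by (rule Zp_multiple)
  ultimately show ?thesis unfolding Qp_iff by blast
qed

lemma padic_algebraic_one_plus_p_power_mult:
  fixes x :: "'p::prime_card padic_hahn"
  assumes "N > 0" "padic_algebraic_number x"
  shows "padic_algebraic_number (one_plus_p_power N \<otimes>\<^bsub>padic_hahn_field\<^esub> x)"
proof -
  interpret cring "padic_hahn_field :: 'p padic_hahn ring" by (rule padic_hahn_field_cring)
  have x: "x \<in> carrier padic_hahn_field" using assms(2) by (simp add: padic_algebraic_number_def)
  have c: "one_plus_p_power N \<in> carrier (padic_hahn_field :: 'p padic_hahn ring)"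
    unfolding one_plus_p_power_def by (rule padic_class_closed) simp
  have "Qp \<subseteq> carrier (padic_hahn_field :: 'p padic_hahn ring)"
    by (auto simp: Qp_iff intro!: padic_class_closed)
  moreover have "(algebraic over Qp) x"
    using assms(2) unfolding padic_algebraic_number_def over_def by blast
  ultimately have "(algebraic over Qp) (one_plus_p_power N \<otimes>\<^bsub>padic_hahn_field\<^esub> x)"
    using c x one_plus_p_power_mult_Qp one_plus_p_power_regular[OF assms(1)]
    by (intro algebraic_mult_regular) simp_all
  then show ?thesis
    using m_closed[OF c x] unfolding padic_algebraic_number_def over_def by blast
qed

text \<open>In the quotient \<open>p\<^sup>N x\<close> equals \<open>t\<^sup>N x\<close>, whose digits are those of \<open>x\<close> moved up by \<open>N\<close>. As the supports of \<open>x\<close> and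
  \<open>t\<^sup>N x\<close> are disjoint, the sum of the two expansions is again an expansion with Teichmueller
  digits, and by uniqueness it is the standard one.\<close>

lemma Supp_one_plus_p_power_mult:
  fixes x :: "'p::prime_card padic_hahn"
  assumes x: "x \<in> carrier padic_hahn_field"
    and disjoint: "\<And>q. q \<in> Supp x \<Longrightarrow> q - of_nat N \<notin> Supp x"
  shows "Supp (one_plus_p_power N \<otimes>\<^bsub>padic_hahn_field\<^esub> x) = Supp x \<union> (\<lambda>q. q + of_nat N) ` Supp x"
proof -
  obtain r where r: "well_ordered (supp r)" "x = padic_class (\<lambda>q. witt_teich (r q))"
    using x by (rule standard_expansion_exists)
  have Supp_x: "Supp x = supp r" unfolding r(2) by (rule Supp_eq[OF r(1)])
  define s where "s q = (if r q = 0 then r (q - of_nat N) else r q)" for q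
  have supp_s: "supp s = supp r \<union> (\<lambda>q. q + of_nat N) ` supp r"
  proof -
    have "q \<in> (\<lambda>q. q + of_nat N) ` supp r \<longleftrightarrow> q - of_nat N \<in> supp r" for q
    proof
      assume "q - of_nat N \<in> supp r"
      then have "(q - of_nat N) + of_nat N \<in> (\<lambda>q. q + of_nat N) ` supp r" by (rule imageI)
      then show "q \<in> (\<lambda>q. q + of_nat N) ` supp r" by simp
    qed auto
    then show ?thesis by (auto simp: supp_def s_def)
  qed
  have "(\<lambda>q. q + of_nat N) ` supp r \<subseteq> sumset (supp r) {of_nat N}"
    by (auto simp: sumset_def)
  then have "well_ordered ((\<lambda>q. q + of_nat N) ` supp r)"
    by (rule well_ordered_subset[OF well_ordered_sumset[OF r(1) well_ordered_singleton]])
  then have wo_s: "well_ordered (supp s)"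
    unfolding supp_s by (rule well_ordered_union[OF r(1)])
  have "witt_teich (s q) = witt_teich (r q) + witt_teich (r (q - of_nat N))" for q
    using disjoint[of q] unfolding Supp_x by (auto simp: s_def supp_def)
  then have diff: "(\<lambda>q. (1 + of_nat CARD('p) ^ N) * witt_teich (r q) - witt_teich (s q)) =
      (\<lambda>q. of_nat CARD('p) ^ N * witt_teich (r q) - witt_teich (r (q - of_nat N)))"
    by (simp add: fun_eq_iff algebra_simps)
  have "one_plus_p_power N \<otimes>\<^bsub>padic_hahn_field\<^esub> x =
      padic_class (\<lambda>q. (1 + of_nat CARD('p) ^ N) * witt_teich (r q))"
    unfolding r(2) using r(1) by (simp add: one_plus_p_power_mult)
  also have "\<dots> = padic_class (\<lambda>q. witt_teich (s q))"
    using r(1) wo_s witt.null_shift[of "\<lambda>q. witt_teich (r q)" N]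
    by (subst padic_class_eq_iff) (simp_all add: well_ordered_supp_scale diff)
  finally show ?thesis using Supp_eq[OF wo_s] by (simp add: supp_s Supp_x)
qed

section \<open>Order types of doubled sets\<close>

lemma Field_le_on [simp]: "Field (le_on S) = S"
  by (auto simp: le_on_def Field_def)

lemma has_order_type_iso:
  assumes "has_order_type S r"
  shows "well_ordered S \<and> (\<exists>\<psi>. bij_betw \<psi> S (Field r) \<and>
    (\<forall>a\<in>S. \<forall>b\<in>S. a \<le> b \<longleftrightarrow> (\<psi> a, \<psi> b) \<in> r))"
proof -
  obtain \<psi> where wo: "Well_order (le_on S)" and iso: "BNF_Wellorder_Embedding.iso (le_on S) r \<psi>"
    using assms unfolding has_order_type_def ordIso_def by blast
  have "a \<le> b \<longleftrightarrow> (\<psi> a, \<psi> b) \<in> r" if "a \<in> S" "b \<in> S" for a b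
    using iso that unfolding iso_iff2 Field_le_on by (simp add: le_on_def)
  moreover have "bij_betw \<psi> S (Field r)"
    using iso unfolding iso_iff2 Field_le_on by blast
  ultimately show ?thesis using wo by (auto simp: well_ordered_def)
qed

text \<open>A translation \<open>\<tau>\<close> of \<open>r\<close> beyond \<open>f\<close>, where \<open>f\<close> corresponds to an element \<open>u\<close> of the upper copy, becomes a
  strictly increasing map from the doubled set into its upper copy. Followed by the
  shift back into the lower copy it gives a strictly increasing map \<open>\<theta>\<close> of the doubled set into
  itself with \<open>\<theta> u < u\<close>, which is impossible in a well-ordered set.\<close>

lemma not_order_type_of_doubled_set:
  fixes S :: "rat set" and N :: rat
  assumes "S \<noteq> {}"
    and below: "\<And>a b. a \<in> S \<Longrightarrow> b \<in> S \<Longrightarrow> a < b + N"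
    and translation: "\<And>f. f \<in> Field r \<Longrightarrow> \<exists>\<tau>. (\<forall>g\<in>Field r. (f, \<tau> g) \<in> r) \<and>
      (\<forall>g h. (g, h) \<in> r \<and> g \<noteq> h \<longrightarrow> (\<tau> g, \<tau> h) \<in> r \<and> \<tau> g \<noteq> \<tau> h)"
  shows "\<not> has_order_type (S \<union> (\<lambda>q. q + N) ` S) r"
proof
  assume type: "has_order_type (S \<union> (\<lambda>q. q + N) ` S) r"
  define U where "U = S \<union> (\<lambda>q. q + N) ` S"
  obtain \<psi> where wo: "well_ordered U" and bij: "bij_betw \<psi> U (Field r)"
    and iso: "\<And>a b. a \<in> U \<Longrightarrow> b \<in> U \<Longrightarrow> a \<le> b \<longleftrightarrow> (\<psi> a, \<psi> b) \<in> r"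
    using has_order_type_iso[OF type] unfolding U_def[symmetric] by blast
  define \<phi> where "\<phi> = inv_into U \<psi>"
  have \<phi>: "\<phi> g \<in> U" "\<psi> (\<phi> g) = g" if "g \<in> Field r" for g
    using that bij by (auto simp: \<phi>_def bij_betw_def f_inv_into_f inv_into_into)
  have \<psi>: "\<psi> u \<in> Field r" if "u \<in> U" for u
    using that bij by (auto simp: bij_betw_def)
  obtain s where s: "s \<in> S" using \<open>S \<noteq> {}\<close> by blast
  define u where "u = s + N"
  have u: "u \<in> U" using s by (simp add: U_def u_def)
  obtain \<tau> where \<tau>_above: "\<And>g. g \<in> Field r \<Longrightarrow> (\<psi> u, \<tau> g) \<in> r"
    and \<tau>_mono: "\<And>g h. (g, h) \<in> r \<Longrightarrow> g \<noteq> h \<Longrightarrow> (\<tau> g, \<tau> h) \<in> r \<and> \<tau> g \<noteq> \<tau> h"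
    using translation[OF \<psi>[OF u]] by blast
  define \<theta> where "\<theta> v = \<phi> (\<tau> (\<psi> v)) - N" for v
  have \<tau>_Field: "\<tau> g \<in> Field r" if "g \<in> Field r" for g
    using \<tau>_above[OF that] by (auto simp: Field_def)
  have \<theta>_S: "\<theta> v \<in> S" if "v \<in> U" for v
  proof -
    let ?w = "\<phi> (\<tau> (\<psi> v))"
    have w: "?w \<in> U" "\<psi> ?w = \<tau> (\<psi> v)" using \<phi> \<tau>_Field \<psi> that by blast+
    then have "u \<le> ?w" using iso[OF u w(1)] \<tau>_above[OF \<psi>[OF that]] by simp
    then have "?w \<notin> S" using below[of ?w s] s by (auto simp: u_def)
    then show ?thesis using w(1) by (auto simp: U_def \<theta>_def)
  qed
  have \<theta>_mono: "\<theta> v < \<theta> w" if "v \<in> U" "w \<in> U" "v < w" for v w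
  proof -
    have "(\<psi> v, \<psi> w) \<in> r"
      using iso[OF \<open>v \<in> U\<close> \<open>w \<in> U\<close>] \<open>v < w\<close> by simp
    moreover have "\<psi> v \<noteq> \<psi> w"
      using bij_betw_imp_inj_on[OF bij] that by (simp add: inj_on_eq_iff)
    ultimately have \<tau>: "(\<tau> (\<psi> v), \<tau> (\<psi> w)) \<in> r" "\<tau> (\<psi> v) \<noteq> \<tau> (\<psi> w)"
      using \<tau>_mono[of "\<psi> v" "\<psi> w"] by simp_all
    have Field: "\<tau> (\<psi> v) \<in> Field r" "\<tau> (\<psi> w) \<in> Field r" using \<tau>_Field \<psi> that by blast+
    have "\<phi> (\<tau> (\<psi> v)) \<le> \<phi> (\<tau> (\<psi> w))"
      using iso[OF \<phi>(1)[OF Field(1)] \<phi>(1)[OF Field(2)]] \<tau>(1) by (simp add: \<phi>(2) Field)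
    moreover have "\<phi> (\<tau> (\<psi> v)) \<noteq> \<phi> (\<tau> (\<psi> w))"
      using \<tau>(2) \<phi>(2) Field by metis
    ultimately show ?thesis by (simp add: \<theta>_def)
  qed
  have SU: "S \<subseteq> U" by (simp add: U_def)
  \<comment> \<open>the least element moved downwards by \<open>\<theta>\<close> would be moved to a smaller one with the same property\<close>
  have "\<theta> u < u" using below[OF \<theta>_S[OF u] s] by (simp add: u_def)
  then have "{v \<in> U. \<theta> v < v} \<noteq> {}" using u by blast
  then obtain m where m: "m \<in> U" "\<theta> m < m" and least: "\<And>v. v \<in> U \<Longrightarrow> \<theta> v < v \<Longrightarrow> m \<le> v"
    using well_ordered_min[OF wo, of "{v \<in> U. \<theta> v < v}"] by blast
  have "\<theta> m \<in> U" using \<theta>_S[OF m(1)] SU by blast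
  moreover from this have "\<theta> (\<theta> m) < \<theta> m" using \<theta>_mono m by blast
  ultimately show False using least m(2) by (metis not_le)
qed

lemma natLeq_translation:
  assumes "f \<in> Field natLeq"
  shows "\<exists>\<tau>. (\<forall>g\<in>Field natLeq. (f, \<tau> g) \<in> natLeq) \<and>
    (\<forall>g h. (g, h) \<in> natLeq \<and> g \<noteq> h \<longrightarrow> (\<tau> g, \<tau> h) \<in> natLeq \<and> \<tau> g \<noteq> \<tau> h)"
  by (rule exI[of _ "\<lambda>g. f + g"]) (auto simp: natLeq_def)

lemma Field_omega_power_omega: "Field omega_power_omega = {f. finite {n. f n \<noteq> 0}}"
  by (auto simp: Field_def omega_power_omega_def)

text \<open>Ordinal addition on the left, \<open>g \<mapsto> f + g\<close>, would serve as well; pointwise addition (the Hessenberg sum) is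
  easier, since adding \<open>f\<close> pointwise does not change the set of arguments at which two functions
  differ.\<close>

lemma omega_power_omega_translation:
  assumes "f \<in> Field omega_power_omega"
  shows "\<exists>\<tau>. (\<forall>g\<in>Field omega_power_omega. (f, \<tau> g) \<in> omega_power_omega) \<and>
    (\<forall>g h. (g, h) \<in> omega_power_omega \<and> g \<noteq> h \<longrightarrow>
      (\<tau> g, \<tau> h) \<in> omega_power_omega \<and> \<tau> g \<noteq> \<tau> h)"
proof (intro exI conjI ballI allI impI)
  let ?\<tau> = "\<lambda>g n. f n + g n"
  have f: "finite {n. f n \<noteq> 0}" using assms by (simp add: Field_omega_power_omega)
  have finite_\<tau>: "finite {n. f n + g n \<noteq> 0}" if "finite {n. g n \<noteq> 0}" for g
    by (rule finite_subset[OF _ finite_UnI[OF f that]]) auto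
  show "(f, ?\<tau> g) \<in> omega_power_omega" if "g \<in> Field omega_power_omega" for g
  proof -
    have g: "finite {n. g n \<noteq> 0}" using that by (simp add: Field_omega_power_omega)
    have "f m < f m + g m" if "m = Max {n. f n \<noteq> f n + g n}" "f \<noteq> ?\<tau> g" for m
    proof -
      have "m \<in> {n. f n \<noteq> f n + g n}"
        unfolding that(1) using g that(2) by (intro Max_in) (auto simp: fun_eq_iff)
      then show ?thesis by simp
    qed
    then show ?thesis using f finite_\<tau>[OF g] unfolding omega_power_omega_def Let_def by blast
  qed
  fix g h assume gh: "(g, h) \<in> omega_power_omega \<and> g \<noteq> h"
  have "{n. f n + g n \<noteq> f n + h n} = {n. g n \<noteq> h n}" by simp
  then show "(?\<tau> g, ?\<tau> h) \<in> omega_power_omega"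
    using gh f by (auto simp: omega_power_omega_def Let_def)
  show "?\<tau> g \<noteq> ?\<tau> h" using gh by (auto simp: fun_eq_iff)
qed

theorem proposition5p2:
  assumes kedlaya_prediction:
    "\<forall>x :: 'p::prime_card padic_hahn. padic_algebraic_number x \<longrightarrow>
       finite (Supp x) \<or> has_order_type (Supp x) natLeq \<or>
       has_order_type (Supp x) omega_power_omega"
  shows "\<forall>x :: 'p padic_hahn. padic_algebraic_number x \<longrightarrow>
       bdd_below (Supp x) \<and> bdd_above (Supp x) \<longrightarrow> finite (Supp x)"
proof (intro allI impI, rule ccontr)
  fix x :: "'p padic_hahn"
  assume alg: "padic_algebraic_number x" and bdd: "bdd_below (Supp x) \<and> bdd_above (Supp x)"
    and inf: "infinite (Supp x)"
  obtain l u where lu: "\<And>q. q \<in> Supp x \<Longrightarrow> l \<le> q \<and> q \<le> u"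
    using bdd unfolding bdd_below_def bdd_above_def by blast
  obtain N :: nat where N: "max 0 (u - l) < of_nat N"
    using reals_Archimedean2 by blast
  have below: "a < b + of_nat N" if "a \<in> Supp x" "b \<in> Supp x" for a b
    using lu[OF that(1)] lu[OF that(2)] N by linarith
  have "N > 0" using N by (cases N) auto
  have x: "x \<in> carrier padic_hahn_field" using alg by (simp add: padic_algebraic_number_def)
  have "q - of_nat N \<notin> Supp x" if "q \<in> Supp x" for q
    using below[OF that, of "q - of_nat N"] by auto
  then have Supp: "Supp (one_plus_p_power N \<otimes>\<^bsub>padic_hahn_field\<^esub> x) = Supp x \<union> (\<lambda>q. q + of_nat N) ` Supp x"
    by (rule Supp_one_plus_p_power_mult[OF x])
  have "padic_algebraic_number (one_plus_p_power N \<otimes>\<^bsub>padic_hahn_field\<^esub> x)"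
    by (rule padic_algebraic_one_plus_p_power_mult[OF \<open>N > 0\<close> alg])
  with kedlaya_prediction
  have "finite (Supp x \<union> (\<lambda>q. q + of_nat N) ` Supp x) \<or>
      has_order_type (Supp x \<union> (\<lambda>q. q + of_nat N) ` Supp x) natLeq \<or>
      has_order_type (Supp x \<union> (\<lambda>q. q + of_nat N) ` Supp x) omega_power_omega"
    unfolding Supp[symmetric] by blast
  moreover have "infinite (Supp x \<union> (\<lambda>q. q + of_nat N) ` Supp x)" using inf by simp
  moreover have "Supp x \<noteq> {}" using inf by auto
  ultimately show False
    using not_order_type_of_doubled_set[OF _ below natLeq_translation]
      not_order_type_of_doubled_set[OF _ below omega_power_omega_translation] by blast
qed
end
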